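(* Fix an integer $r \ge 3$. For positive integers $n$ and $k$, let $\mathcal{H}_{n,k}$ be a connected $r$-uniform hypergraph on $n$ vertices with no Berge path of length $k$ that has the largest possible number of hyperedges among all such hypergraphs. Then $$\lim_{k \to \infty} \lim_{n \to \infty} \frac{|E(\mathcal{H}_{n,k})|}{k^{r-1} n} = \frac{1}{2^{r-1}(r-1)!}.$$
   Context: An $r$-uniform hypergraph consists of a finite vertex set $V(\mathcal{H})$ and a set $E(\mathcal{H})$ of $r$-element subsets of $V(\mathcal{H})$, called hyperedges. A Berge path of length $k$ in a hypergraph is a collection of $k+1$ distinct vertices $v_1, \dots, v_{k+1}$ and $k$ distinct hyperedges $h_1, \dots, h_k$ such that $v_i, v_{i+1} \in h_i$ for all $1 \le i \le k$. If $v_1 = v$ and $v_{k+1} = w$ it is called a Berge $v$-$w$-path. A hypergraph $\mathcal{H}$ is connected if for any $v, w \in V(\mathcal{H})$ there is a Berge $v$-$w$-path (of some length). The limits concern only large $k$ and, for each such $k$, large $n$, where hypergraphs of the described kind exist. *)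

theory Defs
  imports Complex_Main
begin

record 'a hypergraph =
  verts :: "'a set"
  edges :: "'a set set"

definition uniform_hypergraph :: "nat \<Rightarrow> 'a hypergraph \<Rightarrow> bool" where
  "uniform_hypergraph r H \<longleftrightarrow>
     finite (verts H) \<and> (\<forall>e \<in> edges H. e \<subseteq> verts H \<and> card e = r)"

text \<open>The length of the path is \<open>length hs\<close>; a single vertex is a path of length 0.\<close>

definition berge_path :: "'a hypergraph \<Rightarrow> 'a list \<Rightarrow> 'a set list \<Rightarrow> bool" where
  "berge_path H vs hs \<longleftrightarrow>
     length vs = length hs + 1 \<and>
     distinct vs \<and> set vs \<subseteq> verts H \<and>
     distinct hs \<and> set hs \<subseteq> edges H \<and>
     (\<forall>i < length hs. vs ! i \<in> hs ! i \<and> vs ! (i + 1) \<in> hs ! i)"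

definition has_berge_path_of_length :: "'a hypergraph \<Rightarrow> nat \<Rightarrow> bool" where
  "has_berge_path_of_length H k \<longleftrightarrow> (\<exists>vs hs. berge_path H vs hs \<and> length hs = k)"

definition connected_hypergraph :: "'a hypergraph \<Rightarrow> bool" where
  "connected_hypergraph H \<longleftrightarrow>
     (\<forall>v \<in> verts H. \<forall>w \<in> verts H. \<exists>vs hs. berge_path H vs hs \<and> hd vs = v \<and> last vs = w)"

definition admissible :: "nat \<Rightarrow> nat \<Rightarrow> nat \<Rightarrow> 'a hypergraph \<Rightarrow> bool" where
  "admissible r n k H \<longleftrightarrow>
     uniform_hypergraph r H \<and> card (verts H) = n \<and> connected_hypergraph H \<and>
     \<not> has_berge_path_of_length H k"

definition extremal :: "nat \<Rightarrow> nat \<Rightarrow> nat \<Rightarrow> 'a hypergraph \<Rightarrow> bool" where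
  "extremal r n k H \<longleftrightarrow>
     admissible r n k H \<and>
     (\<forall>G :: 'a hypergraph. admissible r n k G \<longrightarrow> card (edges G) \<le> card (edges H))"

end

theory Submission
  imports Defs
begin

text \<open>Upper bound: deleting vertices of degree at most about \<open>(k/2 choose r - 1)\<close> leaves a core of
  bounded size. Indeed every core vertex starts a path of length more than \<open>k/2\<close> inside its component
  of the core, so two components would give a path of length \<open>k\<close>, and in a large component Dirac's
  rotation argument gives one. Lower bound: fix \<open>(k - 1) div 2\<close> vertices and take all edges with exactly
  one vertex outside.

  Both bounds agree only up to lower order terms in \<open>k\<close>, so the inner limit needs an argument of its
  own. A hypergraph without long Berge paths has bounded depth: delete the vertices of an edge, then in
  each remaining component those of an edge leading into it, and so on; these edges form a Berge path,
  so fewer than \<open>k\<close> rounds exhaust everything. Hence, if it has many vertices and density above \<open>\<lambda>\<close>, some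
  bounded vertex set has many attached pieces of bounded size and density above \<open>\<lambda>\<close>, and by
  pigeonhole \<open>k\<close> of them are isomorphic. Taking arbitrarily many copies of such a piece creates no
  path of length \<open>k\<close>, because a path meets at most \<open>k\<close> copies. Since the density has order
  \<open>k ^ (r - 1)\<close>, the piece can at some stage be built up by a single vertex, and partial copies then
  allow every large number of vertices. So a density exceeded once for a large \<open>n\<close> is attained
  asymptotically for all \<open>n\<close>.\<close>

section \<open>Berge paths as paths of the incidence graph\<close>

text \<open>Both bounds owe their constant to \<open>k / 2\<close>. With \<open>s\<close> fixed
  vertices a path has at most \<open>2 * s\<close> edges. Conversely, degrees slightly above
  \<open>m choose (r - 1)\<close> let a path grow to more than \<open>m\<close> edges, and two such
  paths, or the two ends of one path in the rotation argument, make up length \<open>k\<close>.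

  The inner limit is not a case of Fekete's lemma: disjoint unions are disconnected and gluing may
  lengthen paths, so superadditivity in \<open>n\<close> is not at hand. Copies of one piece with a
  common attachment are harmless because a path can be carried back, copy by copy, into the given
  hypergraph. Two obstacles remain. The losses of the decomposition must be bounded independently of
  \<open>n\<close>; hence each round tolerates boundedly many exceptional components and otherwise
  pays by an arbitrarily small slope. And whole copies reach only one residue class of
  \<open>n\<close>, so some partial copies must differ in size by exactly one vertex. What rules out
  growth by larger blocks only is a gap in the order of magnitude: \<open>(r - 1)\<close>-uniform
  hypergraphs without long paths have density of order \<open>k ^ (r - 2)\<close> only.\<close>

fun iadj :: "'a set set \<Rightarrow> 'a + 'a set \<Rightarrow> 'a + 'a set \<Rightarrow> bool" where
  "iadj E (Inl v) (Inr e) \<longleftrightarrow> e \<in> E \<and> v \<in> e"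
| "iadj E (Inr e) (Inl v) \<longleftrightarrow> e \<in> E \<and> v \<in> e"
| "iadj E _ _ \<longleftrightarrow> False"

text \<open>Berge paths are alternating vertex-edge lists, that is, paths of the incidence graph, so that
  they can be appended, reversed and rotated. \<open>lpath E k\<close> is a Berge path with \<open>k\<close> edges.\<close>

definition ipath :: "'a set set \<Rightarrow> ('a + 'a set) list \<Rightarrow> bool" where
  "ipath E xs \<longleftrightarrow> distinct xs \<and> successively (iadj E) xs"

definition lpath :: "'a set set \<Rightarrow> nat \<Rightarrow> bool" where
  "lpath E k \<longleftrightarrow> (\<exists>v xs. ipath E (Inl v # xs) \<and> length xs = 2 * k)"

abbreviation path_verts :: "('a + 'a set) list \<Rightarrow> 'a set" where
  "path_verts xs \<equiv> {v. Inl v \<in> set xs}"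

abbreviation path_edges :: "('a + 'a set) list \<Rightarrow> 'a set set" where
  "path_edges xs \<equiv> {e. Inr e \<in> set xs}"

text \<open>Connectivity is treated as reachability by \<open>link\<close>, whose walks may repeat
  vertices and edges; \<open>link_rtrancl_ipath\<close> turns a walk into a path where one is
  required.\<close>

definition link :: "'a set set \<Rightarrow> 'a rel" where
  "link E = {(u, w). \<exists>e\<in>E. u \<in> e \<and> w \<in> e}"

lemma iadj_sym: "iadj E x y = iadj E y x"
  by (cases x; cases y) auto

lemma iadj_mono: "iadj E x y \<Longrightarrow> E \<subseteq> F \<Longrightarrow> iadj F x y"
  by (cases x; cases y) auto

lemma ipath_mono: "ipath E xs \<Longrightarrow> E \<subseteq> F \<Longrightarrow> ipath F xs"
  unfolding ipath_def using iadj_mono by (metis successively_mono)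

lemma ipath_rev [simp]: "ipath E (rev xs) \<longleftrightarrow> ipath E xs"
proof -
  have "(\<lambda>x y. iadj E y x) = iadj E" using iadj_sym by blast
  then show ?thesis unfolding ipath_def successively_rev distinct_rev by (rule arg_cong)
qed

lemma ipath_append:
  "ipath E (xs @ ys) \<longleftrightarrow> ipath E xs \<and> ipath E ys \<and> set xs \<inter> set ys = {} \<and>
     (xs = [] \<or> ys = [] \<or> iadj E (last xs) (hd ys))"
  unfolding ipath_def by (auto simp: successively_append_iff)

lemma ipath_Nil [simp]: "ipath E []" and ipath_single [simp]: "ipath E [x]"
  by (auto simp: ipath_def)

lemma ipath_Cons:
  "ipath E (x # xs) \<longleftrightarrow> x \<notin> set xs \<and> ipath E xs \<and> (xs = [] \<or> iadj E x (hd xs))"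
  using ipath_append[of E "[x]" xs] by auto

lemma ipath_take: "ipath E xs \<Longrightarrow> ipath E (take n xs)"
  by (metis append_take_drop_id ipath_append)

lemma lpathI:
  assumes "ipath E xs" "xs \<noteq> []" "hd xs = Inl v" "2 * k < length xs"
  shows "lpath E k"
proof -
  have "take (2*k+1) xs = Inl v # take (2*k) (tl xs)"
    using assms(2,3) by (cases xs) auto
  with ipath_take[OF assms(1), of "2*k+1"] assms(4) show ?thesis
    unfolding lpath_def by (intro exI[of _ v] exI[of _ "take (2*k) (tl xs)"]) auto
qed

text \<open>A path that starts with an edge loses this first entry, whence a bound larger by one
  than in \<open>lpathI\<close>.\<close>

lemma lpathI':
  assumes "ipath E xs" "2 * k + 1 < length xs"
  shows "lpath E k"
proof (cases xs)
  case (Cons x ys)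
  show ?thesis
  proof (cases x)
    case (Inl v)
    then show ?thesis using assms Cons by (intro lpathI[of E xs v]) auto
  next
    case (Inr e)
    with assms Cons have "ys \<noteq> []" "iadj E x (hd ys)" "ipath E ys" by (auto simp: ipath_Cons)
    then obtain v where "hd ys = Inl v" using Inr by (cases "hd ys") auto
    then show ?thesis using assms Cons \<open>ys \<noteq> []\<close> \<open>ipath E ys\<close> by (intro lpathI[of E ys v]) auto
  qed
qed (use assms in auto)

lemma lpath_mono: "lpath E k \<Longrightarrow> E \<subseteq> F \<Longrightarrow> lpath F k"
  unfolding lpath_def using ipath_mono by blast

lemma ipath_edge_mem: "ipath E xs \<Longrightarrow> Inr e \<in> set xs \<Longrightarrow> 2 \<le> length xs \<Longrightarrow> e \<in> E"
proof (induction xs)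
  case (Cons x xs)
  show ?case
  proof (cases xs)
    case (Cons y ys)
    show ?thesis
    proof (cases "x = Inr e")
      case True
      then show ?thesis using Cons.prems Cons by (cases y) (auto simp: ipath_Cons)
    next
      case False
      with Cons.prems have e: "Inr e \<in> set xs" by auto
      show ?thesis
      proof (cases ys)
        case Nil
        then show ?thesis using Cons.prems Cons e by (cases x) (auto simp: ipath_Cons)
      next
        case (Cons z zs)
        then show ?thesis using Cons.IH Cons.prems \<open>xs = y # ys\<close> e by (auto simp: ipath_Cons)
      qed
    qed
  qed (use Cons.prems in auto)
qed auto

text \<open>The degenerate path \<open>[Inr e]\<close> has no edge condition; paths starting at a vertex do.\<close>

lemma ipath_edges_subset: "ipath E (Inl v # xs) \<Longrightarrow> path_edges (Inl v # xs) \<subseteq> E"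
  using ipath_edge_mem[of E "Inl v # xs"] by (cases xs) auto

lemma ipath_verts_subset:
  assumes "ipath E (Inl v # xs)"
  shows "path_verts (Inl v # xs) \<subseteq> insert v (\<Union>E)"
proof
  fix w assume "w \<in> path_verts (Inl v # xs)"
  then consider "w = v" | "Inl w \<in> set xs" by auto
  then show "w \<in> insert v (\<Union>E)"
  proof cases
    case 2
    then obtain ys zs where xs: "xs = ys @ Inl w # zs" by (metis split_list)
    then have "ipath E ((Inl v # ys) @ Inl w # zs)" using assms by simp
    then have "iadj E (last (Inl v # ys)) (Inl w)" by (simp only: ipath_append) auto
    then show ?thesis by (cases "last (Inl v # ys)") auto
  qed auto
qed

lemma ipath_cards:
  "ipath E (Inl v # xs) \<Longrightarrow> length xs = 2 * k \<Longrightarrow>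
    card (path_verts (Inl v # xs)) = k + 1 \<and> card (path_edges (Inl v # xs)) = k \<and>
    (\<exists>w. last (Inl v # xs) = Inl w)"
proof (induction k arbitrary: v xs)
  case (Suc k)
  then obtain x y ys where xs: "xs = x # y # ys" by (metis length_Suc_conv mult_Suc_right add_2_eq_Suc)
  from Suc.prems xs obtain e where e: "x = Inr e" by (cases x) (auto simp: ipath_Cons)
  from Suc.prems xs e obtain w where w: "y = Inl w" by (cases y) (auto simp: ipath_Cons)
  have p: "ipath E (Inl w # ys)" "length ys = 2 * k" using Suc.prems xs e w by (auto simp: ipath_Cons)
  note IH = Suc.IH[OF this]
  have "path_verts (Inl v # xs) = insert v (path_verts (Inl w # ys))" using xs e w by auto
  moreover have "path_edges (Inl v # xs) = insert e (path_edges (Inl w # ys))" using xs e w by auto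
  moreover have "v \<notin> path_verts (Inl w # ys)" "e \<notin> path_edges (Inl w # ys)"
    using Suc.prems xs e w by (auto simp: ipath_Cons)
  moreover have "finite (path_verts (Inl w # ys))" "finite (path_edges (Inl w # ys))"
    using finite_vimageI[of "set (Inl w # ys)" Inl] finite_vimageI[of "set (Inl w # ys)" Inr]
    by (auto simp: vimage_def inj_def simp del: set_simps)
  ultimately have "card (path_verts (Inl v # xs)) = Suc (card (path_verts (Inl w # ys)))"
     "card (path_edges (Inl v # xs)) = Suc (card (path_edges (Inl w # ys)))"
    by (metis card_insert_disjoint)+
  then show ?case using IH xs w by (auto split: if_splits)
qed auto

lemma finite_path_sets [simp]: "finite (path_verts xs)" "finite (path_edges xs)"
  using finite_vimageI[of "set xs" Inl] finite_vimageI[of "set xs" Inr]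
  by (auto simp: vimage_def inj_def)

section \<open>Translation of Berge paths into incidence paths and back\<close>

lemma berge_to_ipath:
  "length vs = length hs + 1 \<Longrightarrow> distinct vs \<Longrightarrow> distinct hs \<Longrightarrow> set hs \<subseteq> E \<Longrightarrow>
   \<forall>i<length hs. vs ! i \<in> hs ! i \<and> vs ! (i + 1) \<in> hs ! i \<Longrightarrow>
   \<exists>xs. ipath E (Inl (hd vs) # xs) \<and> length xs = 2 * length hs \<and>
      last (Inl (hd vs) # xs) = Inl (last vs) \<and>
      path_verts (Inl (hd vs) # xs) = set vs \<and> path_edges xs = set hs"
proof (induction hs arbitrary: vs)
  case Nil
  then obtain v where "vs = [v]" by (cases vs) auto
  then show ?case by (intro exI[of _ "[]"]) auto
next
  case (Cons h hs)
  then obtain v ws where vs: "vs = v # ws" "length ws = length hs + 1" by (cases vs) auto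
  have "\<forall>i<length hs. ws ! i \<in> hs ! i \<and> ws ! (i + 1) \<in> hs ! i"
    using Cons.prems(5) vs by fastforce
  from Cons.IH[OF vs(2) _ _ _ this] Cons.prems vs(1)
  obtain xs where xs: "ipath E (Inl (hd ws) # xs)" "length xs = 2 * length hs"
      "last (Inl (hd ws) # xs) = Inl (last ws)"
      "path_verts (Inl (hd ws) # xs) = set ws" "path_edges xs = set hs" by auto
  have ws: "ws \<noteq> []" using vs(2) by auto
  have "v \<in> h" "hd ws \<in> h" using Cons.prems(5) vs ws by (auto simp: hd_conv_nth)
  moreover have "v \<notin> set ws" "h \<notin> set hs" "h \<in> E" using Cons.prems vs by auto
  ultimately have "ipath E (Inl v # Inr h # Inl (hd ws) # xs)"
    using xs by (auto simp: ipath_Cons)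
  then show ?case using xs vs ws by (intro exI[of _ "Inr h # Inl (hd ws) # xs"]) auto
qed

lemma ipath_to_berge:
  "ipath E (Inl v # xs) \<Longrightarrow> length xs = 2 * k \<Longrightarrow>
   \<exists>vs hs. length vs = length hs + 1 \<and> distinct vs \<and> distinct hs \<and> set hs = path_edges xs \<and>
     set vs = path_verts (Inl v # xs) \<and> hd vs = v \<and> Inl (last vs) = last (Inl v # xs) \<and> length hs = k \<and>
     (\<forall>i<length hs. vs ! i \<in> hs ! i \<and> vs ! (i + 1) \<in> hs ! i)"
proof (induction k arbitrary: v xs)
  case 0
  then show ?case by (intro exI[of _ "[v]"] exI[of _ "[]"]) auto
next
  case (Suc k)
  then obtain x y ys where xs: "xs = x # y # ys" by (metis length_Suc_conv mult_Suc_right add_2_eq_Suc)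
  from Suc.prems xs obtain e where e: "x = Inr e" by (cases x) (auto simp: ipath_Cons)
  from Suc.prems xs e obtain w where w: "y = Inl w" by (cases y) (auto simp: ipath_Cons)
  have p: "ipath E (Inl w # ys)" "length ys = 2 * k" using Suc.prems xs e w by (auto simp: ipath_Cons)
  from Suc.IH[OF this] obtain vs hs where IH: "length vs = length hs + 1" "distinct vs" "distinct hs"
     "set hs = path_edges ys" "set vs = path_verts (Inl w # ys)" "hd vs = w"
     "Inl (last vs) = last (Inl w # ys)" "length hs = k"
     "\<forall>i<length hs. vs ! i \<in> hs ! i \<and> vs ! (i + 1) \<in> hs ! i" by blast
  have ve: "v \<in> e" "w \<in> e" using Suc.prems xs e w by (auto simp: ipath_Cons)
  have "vs \<noteq> []" using IH(1) by auto
  then have vs0: "vs ! 0 = w" using IH(6) by (simp add: hd_conv_nth)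
  have "\<forall>i<length (e # hs). (v # vs) ! i \<in> (e # hs) ! i \<and> (v # vs) ! (i + 1) \<in> (e # hs) ! i"
    using IH(9) ve vs0 by (auto simp: nth_Cons split: nat.split)
  moreover have "distinct (v # vs)" "distinct (e # hs)"
    using IH Suc.prems xs e w by (auto simp: ipath_Cons)
  ultimately show ?case using IH xs e w \<open>vs \<noteq> []\<close>
    by (intro exI[of _ "v # vs"] exI[of _ "e # hs"]) auto
qed

text \<open>\<open>lpath\<close> does not ask its first vertex to lie in \<open>verts H\<close>; for
  \<open>k \<ge> 1\<close> the first edge contains this vertex and forces it. At
  \<open>k = 0\<close> the equivalence fails for the empty hypergraph.\<close>

lemma has_berge_path_iff_lpath:
  assumes "\<And>e. e \<in> edges H \<Longrightarrow> e \<subseteq> verts H" "k \<ge> 1"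
  shows "has_berge_path_of_length H k \<longleftrightarrow> lpath (edges H) k"
proof
  assume "has_berge_path_of_length H k"
  then show "lpath (edges H) k"
    unfolding has_berge_path_of_length_def berge_path_def lpath_def using berge_to_ipath by metis
next
  assume "lpath (edges H) k"
  then obtain v xs where xs: "ipath (edges H) (Inl v # xs)" "length xs = 2 * k"
    by (auto simp: lpath_def)
  then obtain y ys where "xs = y # ys" using assms(2) by (cases xs) auto
  then have "v \<in> \<Union>(edges H)" using xs by (cases y) (auto simp: ipath_Cons)
  with ipath_verts_subset[OF xs(1)] assms(1) have V: "path_verts (Inl v # xs) \<subseteq> verts H" by blast
  have "path_edges xs \<subseteq> edges H" using ipath_edges_subset[OF xs(1)] by auto
  with ipath_to_berge[OF xs] V show "has_berge_path_of_length H k"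
    unfolding has_berge_path_of_length_def berge_path_def by metis
qed

section \<open>Connectedness as reachability\<close>

text \<open>The walk is shortened as it grows: the path found so far is cut where it already meets
  the next vertex or, failing that, the next edge, from which one steps to the new vertex.\<close>

lemma link_rtrancl_ipath:
  assumes "(v, w) \<in> (link E)\<^sup>*"
  shows "\<exists>xs. ipath E (Inl v # xs) \<and> last (Inl v # xs) = Inl w"
  using assms
proof (induction rule: rtrancl_induct)
  case base
  show ?case by (intro exI[of _ "[]"]) auto
next
  case (step u w)
  then obtain xs where xs: "ipath E (Inl v # xs)" "last (Inl v # xs) = Inl u" by blast
  from step(2) obtain e where e: "e \<in> E" "u \<in> e" "w \<in> e" by (auto simp: link_def)
  have prefix: "\<exists>ys. ipath E (Inl v # ys) \<and> last (Inl v # ys) = x \<and> set (Inl v # ys) \<subseteq> set (Inl v # xs)"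
    if "x \<in> set (Inl v # xs)" for x
  proof -
    from that obtain as bs where ab: "Inl v # xs = as @ x # bs" by (metis split_list)
    then have "ipath E (as @ [x])" using xs(1) by (auto simp: ipath_append ipath_Cons)
    moreover obtain ys where "as @ [x] = Inl v # ys" using ab by (cases as) auto
    ultimately show ?thesis using ab
      by (intro exI[of _ ys]) (metis Un_iff last_snoc set_append subsetI list.set_intros insert_iff list.set(2) append.assoc append_Cons append_Nil)
  qed
  consider "Inl w \<in> set (Inl v # xs)" | "Inl w \<notin> set (Inl v # xs)" "Inr e \<in> set (Inl v # xs)"
    | "Inl w \<notin> set (Inl v # xs)" "Inr e \<notin> set (Inl v # xs)" by blast
  then show ?case
  proof cases
    case 1
    then show ?thesis using prefix by blast
  next
    case 2
    then obtain ys where ys: "ipath E (Inl v # ys)" "last (Inl v # ys) = Inr e"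
       "set (Inl v # ys) \<subseteq> set (Inl v # xs)" using prefix by blast
    then have "ipath E ((Inl v # ys) @ [Inl w])"
      using 2 e by (subst ipath_append) auto
    then show ?thesis by (intro exI[of _ "ys @ [Inl w]"]) auto
  next
    case 3
    then have "ipath E ((Inl v # xs) @ [Inr e, Inl w])"
      using xs e by (subst ipath_append) (auto simp: ipath_Cons)
    then show ?thesis by (intro exI[of _ "xs @ [Inr e, Inl w]"]) auto
  qed
qed

lemma ipath_odd:
  assumes "ipath E (Inl v # xs)" "last (Inl v # xs) = Inl w"
  shows "even (length xs)"
  using assms
proof (induction "length xs" arbitrary: v xs rule: less_induct)
  case less
  show ?case
  proof (cases xs)
    case (Cons x ys)
    then obtain e where e: "x = Inr e" using less.prems by (cases x) (auto simp: ipath_Cons)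
    show ?thesis
    proof (cases ys)
      case Nil
      then show ?thesis using less.prems Cons e by auto
    next
      case (Cons y zs)
      then obtain u where u: "y = Inl u" using less.prems \<open>xs = x # ys\<close> e by (cases y) (auto simp: ipath_Cons)
      have "even (length zs)"
        using less.hyps[of zs u] less.prems \<open>xs = x # ys\<close> Cons e u by (auto simp: ipath_Cons)
      then show ?thesis using \<open>xs = x # ys\<close> Cons by simp
    qed
  qed auto
qed

lemma ipath_link_rtrancl:
  "length xs = 2 * k \<Longrightarrow> ipath E (Inl v # xs) \<Longrightarrow> last (Inl v # xs) = Inl w \<Longrightarrow> (v, w) \<in> (link E)\<^sup>*"
proof (induction k arbitrary: v xs)
  case (Suc k)
  then obtain x y ys where xs: "xs = x # y # ys" by (metis length_Suc_conv mult_Suc_right add_2_eq_Suc)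
  from Suc.prems xs obtain e where e: "x = Inr e" by (cases x) (auto simp: ipath_Cons)
  from Suc.prems xs e obtain u where u: "y = Inl u" by (cases y) (auto simp: ipath_Cons)
  have "(u, w) \<in> (link E)\<^sup>*" using Suc.IH[of ys u] Suc.prems xs e u by (auto simp: ipath_Cons)
  moreover have "(v, u) \<in> link E" using Suc.prems xs e u by (auto simp: ipath_Cons link_def)
  ultimately show ?case by (rule converse_rtrancl_into_rtrancl[rotated])
qed auto

lemma connected_hypergraph_iff_link:
  assumes "\<And>e. e \<in> edges H \<Longrightarrow> e \<subseteq> verts H"
  shows "connected_hypergraph H \<longleftrightarrow> (\<forall>v\<in>verts H. \<forall>w\<in>verts H. (v, w) \<in> (link (edges H))\<^sup>*)"
proof
  assume c: "connected_hypergraph H"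
  show "\<forall>v\<in>verts H. \<forall>w\<in>verts H. (v, w) \<in> (link (edges H))\<^sup>*"
  proof (intro ballI)
    fix v w assume "v \<in> verts H" "w \<in> verts H"
    then obtain vs hs where b: "berge_path H vs hs" "hd vs = v" "last vs = w"
      using c unfolding connected_hypergraph_def by blast
    then obtain xs where "ipath (edges H) (Inl v # xs)" "length xs = 2 * length hs"
       "last (Inl v # xs) = Inl w"
      using berge_to_ipath[of vs hs "edges H"] unfolding berge_path_def by auto
    then show "(v, w) \<in> (link (edges H))\<^sup>*" by (intro ipath_link_rtrancl)
  qed
next
  assume c: "\<forall>v\<in>verts H. \<forall>w\<in>verts H. (v, w) \<in> (link (edges H))\<^sup>*"
  show "connected_hypergraph H"
    unfolding connected_hypergraph_def
  proof (intro ballI)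
    fix v w assume vw: "v \<in> verts H" "w \<in> verts H"
    then obtain xs where xs: "ipath (edges H) (Inl v # xs)" "last (Inl v # xs) = Inl w"
      using c link_rtrancl_ipath by metis
    then obtain k where k: "length xs = 2 * k" using ipath_odd by (metis evenE)
    have V: "path_verts (Inl v # xs) \<subseteq> verts H"
      using ipath_verts_subset[OF xs(1)] vw assms by blast
    have "path_edges xs \<subseteq> edges H" using ipath_edges_subset[OF xs(1)] by auto
    with ipath_to_berge[OF xs(1) k] V xs(2)
    show "\<exists>vs hs. berge_path H vs hs \<and> hd vs = v \<and> last vs = w"
      unfolding berge_path_def by (metis sum.inject(1))
  qed
qed

section \<open>Cores and the upper bound\<close>

lemma card_subsets_containing:
  assumes "finite X" "u \<in> X" "s \<ge> 1"
  shows "card {e. u \<in> e \<and> e \<subseteq> X \<and> card e = s} = (card X - 1) choose (s - 1)"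
proof -
  have "{e. u \<in> e \<and> e \<subseteq> X \<and> card e = s} = insert u ` {B. B \<subseteq> X - {u} \<and> card B = s - 1}" (is "?L = ?R")
  proof
    show "?L \<subseteq> ?R"
    proof
      fix e assume e: "e \<in> ?L"
      then have "e = insert u (e - {u})" by auto
      moreover have "card (e - {u}) = s - 1" using e assms by (simp add: card_Diff_singleton finite_subset)
      ultimately show "e \<in> ?R" using e by blast
    qed
    show "?R \<subseteq> ?L"
    proof
      fix e assume "e \<in> ?R"
      then obtain B where B: "e = insert u B" "B \<subseteq> X - {u}" "card B = s - 1" by blast
      then have "finite B" "u \<notin> B" using assms(1) finite_subset by auto
      then show "e \<in> ?L" using B assms by auto
    qed
  qed
  moreover have "inj_on (insert u) {B. B \<subseteq> X - {u} \<and> card B = s - 1}"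
    by (auto simp: inj_on_def)
  ultimately have "card {e. u \<in> e \<and> e \<subseteq> X \<and> card e = s} = card {B. B \<subseteq> X - {u} \<and> card B = s - 1}"
    by (simp add: card_image)
  then show ?thesis using assms n_subsets[of "X - {u}" "s - 1"] by simp
qed

text \<open>Each deleted vertex destroys at most \<open>D\<close> edges, and deletion stops only
  when all degrees inside the remaining set exceed \<open>D\<close>.\<close>

lemma exists_core:
  assumes "finite V" "finite E" "\<Union>E \<subseteq> V"
  shows "\<exists>C\<subseteq>V. (\<forall>v\<in>C. D < card {e\<in>E. e \<subseteq> C \<and> v \<in> e}) \<and>
    card E \<le> D * card (V - C) + card {e\<in>E. e \<subseteq> C}"
  using assms
proof (induction "card V" arbitrary: V E rule: less_induct)
  case less
  show ?case
  proof (cases "\<exists>v\<in>V. card {e\<in>E. v \<in> e} \<le> D")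
    case False
    have "{e\<in>E. e \<subseteq> V \<and> v \<in> e} = {e\<in>E. v \<in> e}" for v using less.prems by auto
    moreover have "{e\<in>E. e \<subseteq> V} = E" using less.prems by auto
    ultimately show ?thesis using False by (intro exI[of _ V]) auto
  next
    case True
    then obtain v where v: "v \<in> V" "card {e\<in>E. v \<in> e} \<le> D" by blast
    let ?E = "{e\<in>E. v \<notin> e}"
    have "card (V - {v}) < card V" using v less.prems by (meson card_Diff1_less)
    from less.hyps[OF this, of ?E] less.prems
    obtain C where C: "C \<subseteq> V - {v}" "\<forall>u\<in>C. D < card {e\<in>?E. e \<subseteq> C \<and> u \<in> e}"
      "card ?E \<le> D * card (V - {v} - C) + card {e\<in>?E. e \<subseteq> C}" by auto
    have eq: "{e\<in>?E. e \<subseteq> C \<and> u \<in> e} = {e\<in>E. e \<subseteq> C \<and> u \<in> e}" "{e\<in>?E. e \<subseteq> C} = {e\<in>E. e \<subseteq> C}" for u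
      using C(1) by auto
    have "card E = card ?E + card {e\<in>E. v \<in> e}"
      using less.prems by (subst card_Un_disjoint[symmetric]) (auto intro: arg_cong[of _ _ card])
    moreover have "card (V - C) = Suc (card (V - {v} - C))"
    proof -
      have "V - C = insert v (V - {v} - C)" using v C by auto
      then show ?thesis using less.prems by (metis (no_types, lifting) DiffD1 Diff_iff card_insert_disjoint finite_Diff insertI1)
    qed
    ultimately have "card E \<le> D * card (V - C) + card {e\<in>E. e \<subseteq> C}"
      using C(3) v(2) unfolding eq by simp
    then show ?thesis using C unfolding eq by blast
  qed
qed

lemma ipath_snoc2:
  assumes "ipath E xs" "xs \<noteq> []" "last xs = Inl u" "e \<in> E" "u \<in> e" "w \<in> e"
    "Inr e \<notin> set xs" "Inl w \<notin> set xs"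
  shows "ipath E (xs @ [Inr e, Inl w])"
  using assms by (auto simp: ipath_append ipath_Cons)

text \<open>Greedy extension: at the end \<open>u\<close> of a path with \<open>l \<le> m\<close>
  edges, an edge is useless only if it is one of these \<open>l\<close> edges or lies within the
  \<open>l + 1\<close> path vertices, which leaves \<open>l choose (s - 1)\<close> candidates
  through \<open>u\<close>. The degree exceeds both numbers together.\<close>

lemma long_ipath_from:
  assumes fin: "finite E" and unif: "\<And>e. e \<in> E \<Longrightarrow> card e = s" "s \<ge> 1" and sub: "\<Union>E \<subseteq> C"
    and deg: "\<And>u. u \<in> C \<Longrightarrow> m + (m choose (s - 1)) < card {e\<in>E. u \<in> e}"
    and v: "v \<in> C" and l: "l \<le> m + 1"
  shows "\<exists>xs. ipath E (Inl v # xs) \<and> length xs = 2 * l"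
  using l
proof (induction l)
  case 0
  then show ?case by (intro exI[of _ "[]"]) auto
next
  case (Suc l)
  then obtain xs where xs: "ipath E (Inl v # xs)" "length xs = 2 * l" by auto
  from ipath_cards[OF xs] obtain u where
    cards: "card (path_verts (Inl v # xs)) = l + 1" "card (path_edges (Inl v # xs)) = l"
      "last (Inl v # xs) = Inl u" by auto
  let ?X = "path_verts (Inl v # xs)" and ?U = "path_edges (Inl v # xs)"
  have uX: "u \<in> ?X" using cards(3) last_in_set[of "Inl v # xs"] by force
  then have uC: "u \<in> C" using ipath_verts_subset[OF xs(1)] sub v by blast
  have "\<exists>e\<in>E. u \<in> e \<and> e \<notin> ?U \<and> \<not> e \<subseteq> ?X"
  proof (rule ccontr)
    assume "\<not> ?thesis"
    then have "{e\<in>E. u \<in> e} \<subseteq> ?U \<union> {e. u \<in> e \<and> e \<subseteq> ?X \<and> card e = s}" using unif by blast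
    then have "card {e\<in>E. u \<in> e} \<le> card (?U \<union> {e. u \<in> e \<and> e \<subseteq> ?X \<and> card e = s})"
      by (intro card_mono) (auto intro: finite_subset[of _ "Pow ?X"] simp del: set_simps)
    also have "\<dots> \<le> l + (l choose (s - 1))"
      using card_Un_le[of ?U "{e. u \<in> e \<and> e \<subseteq> ?X \<and> card e = s}"]
        card_subsets_containing[of ?X u s] uX unif(2) cards by (simp del: set_simps)
    also have "\<dots> \<le> m + (m choose (s - 1))" using Suc.prems by (intro add_mono binomial_right_mono) auto
    finally show False using deg[OF uC] by simp
  qed
  then obtain e w where ew: "e \<in> E" "u \<in> e" "e \<notin> ?U" "w \<in> e" "w \<notin> ?X" by blast
  have "ipath E ((Inl v # xs) @ [Inr e, Inl w])"
    using ew xs cards by (intro ipath_snoc2) auto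
  then show ?case using xs by (intro exI[of _ "xs @ [Inr e, Inl w]"]) auto
qed

section \<open>Rotation in a connected hypergraph of high degree\<close>

lemma ipath_nth:
  assumes "ipath E (Inl v # xs)"
  shows "j < length (Inl v # xs) \<Longrightarrow>
    (even j \<longrightarrow> (\<exists>w. (Inl v # xs) ! j = Inl w)) \<and> (odd j \<longrightarrow> (\<exists>e. (Inl v # xs) ! j = Inr e))"
proof (induction j)
  case (Suc j)
  then have "iadj E ((Inl v # xs) ! j) ((Inl v # xs) ! Suc j)"
    using assms unfolding ipath_def successively_conv_nth by blast
  with Suc show ?case
    by (cases "(Inl v # xs) ! j"; cases "(Inl v # xs) ! Suc j") auto
qed auto

text \<open>A closed path can be cut open in front of any of its entries.\<close>

lemma ipath_rotate:
  assumes "ipath E (as @ x # bs)" "iadj E (last (x # bs)) (hd (as @ [x]))"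
  shows "ipath E (x # bs @ as)"
proof -
  have "ipath E as" "ipath E (x # bs)" "set as \<inter> set (x # bs) = {}" using assms(1) by (auto simp: ipath_append)
  then have "ipath E ((x # bs) @ as)" using assms(2) by (subst ipath_append) (auto simp: hd_append)
  then show ?thesis by simp
qed

lemma rtrancl_exits:
  assumes "(u, w) \<in> R\<^sup>*" "u \<in> X" "w \<notin> X"
  shows "\<exists>a b. (a, b) \<in> R \<and> a \<in> X \<and> b \<notin> X"
  using assms
proof (induction rule: rtrancl_induct)
  case (step y z)
  then show ?case by (cases "y \<in> X") auto
qed auto

text \<open>The list \<open>cs\<close> is a closed Berge path; it is cut open next to the edge \<open>g\<close>.\<close>

lemma cycle_extends:
  assumes cyc: "ipath E cs" "cs \<noteq> []" "iadj E (last cs) (hd cs)" "length cs = 2 * l"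
    and g: "g \<in> E" "a \<in> g" "Inl a \<in> set cs" "b \<in> g" "Inl b \<notin> set cs"
  shows "lpath E l"
proof (cases "Inr g \<in> set cs")
  case True
  then obtain as bs where cs: "cs = as @ Inr g # bs" by (metis split_list)
  have "ipath E (Inr g # bs @ as)"
    using cyc cs by (intro ipath_rotate) (auto simp: hd_append split: if_splits)
  then have "ipath E (Inl b # Inr g # bs @ as)" using g cs by (auto simp: ipath_Cons)
  then show ?thesis using cyc cs by (intro lpathI) auto
next
  case False
  from g obtain as bs where cs: "cs = as @ Inl a # bs" by (metis split_list)
  have "ipath E (Inl a # bs @ as)"
    using cyc cs by (intro ipath_rotate) (auto simp: hd_append split: if_splits)
  then have "ipath E (Inl b # Inr g # Inl a # bs @ as)" using g cs False by (auto simp: ipath_Cons)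
  then show ?thesis using cyc cs by (intro lpathI) auto
qed

text \<open>If a path with \<open>l\<close> edges cannot be replaced by a longer one, the edges at
  its ends that are not on it stay within its vertices. Their number forces a crossing pair, which
  closes the path to a cycle on the same vertices. Since \<open>K\<close> is connected and has more
  than \<open>k\<close> vertices, an edge leaves the cycle, and opening the cycle there gives
  \<open>l + 1\<close> edges.\<close>

lemma dirac_step:
  assumes fin: "finite E" and unif: "\<And>e. e \<in> E \<Longrightarrow> card e = r" "r \<ge> 2" and sub: "\<Union>E \<subseteq> K"
    and conn: "\<And>u w. u \<in> K \<Longrightarrow> w \<in> K \<Longrightarrow> (u, w) \<in> (link E)\<^sup>*"
    and deg: "\<And>u. u \<in> K \<Longrightarrow> (m choose (r - 1)) + k + (k choose (r - 2)) < card {e\<in>E. u \<in> e}"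
    and k: "k \<le> 2 * m + 2" and K: "k < card K"
    and l: "l < k" "lpath E l"
  shows "lpath E (l + 1)"
proof (rule ccontr)
  assume no: "\<not> lpath E (l + 1)"
  from l(2) K obtain p xs where P0: "ipath E (Inl p # xs)" "length xs = 2 * l" "p \<in> K"
  proof (cases "l = 0")
    \<comment> \<open>An empty path may sit at any vertex of the type, so its vertex is chosen
      afresh in \<open>K\<close>.\<close>
    case True
    obtain p where "p \<in> K" using K by fastforce
    then show ?thesis using True that[of p "[]"] by auto
  next
    case False
    obtain p xs where xs: "ipath E (Inl p # xs)" "length xs = 2 * l" using l(2) by (auto simp: lpath_def)
    then obtain e ys where "xs = e # ys" using False by (cases xs) auto
    then have "p \<in> \<Union>E" using xs by (cases e) (auto simp: ipath_Cons)
    then show ?thesis using that xs sub by blast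
  qed
  define P where "P = Inl p # xs"
  note P = P0[folded P_def]
  have lenP: "length P = 2 * l + 1" using P by (simp add: P_def)
  define v where "v i = projl (P ! (2 * i))" for i
  have Pv: "P ! (2 * i) = Inl (v i)" if "i \<le> l" for i
    using ipath_nth[OF P0(1), of "2 * i"] that P0(2) unfolding v_def P_def by auto
  let ?X = "path_verts P" and ?U = "path_edges P"
  have cX: "card ?X = l + 1" and cU: "card ?U = l"
    using ipath_cards[OF P0(1,2)] unfolding P_def by auto
  have lastP: "last P = Inl (v l)" 
  proof -
    have "P \<noteq> []" by (simp add: P_def)
    then show ?thesis using Pv[of l] lenP by (simp add: last_conv_nth)
  qed
  have hdP: "hd P = Inl (v 0)" using Pv[of 0] by (simp add: P_def)
  have XK: "?X \<subseteq> K" using ipath_verts_subset[OF P0(1)] sub P0(3) unfolding P_def by blast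
  have X: "?X = v ` {..l}"
  proof
    show "v ` {..l} \<subseteq> ?X"
    proof safe
      fix i assume "i \<le> l"
      then have "P ! (2 * i) \<in> set P" using lenP by (intro nth_mem) simp
      then show "Inl (v i) \<in> set P" using Pv[OF \<open>i \<le> l\<close>] by simp
    qed
    show "?X \<subseteq> v ` {..l}"
    proof
      fix w assume "w \<in> ?X"
      then obtain j where j: "j < length P" "P ! j = Inl w" by (auto simp: in_set_conv_nth)
      then have "even j" using ipath_nth[OF P0(1), of j] unfolding P_def by auto
      then obtain i where "j = 2 * i" by (auto elim: evenE)
      then have "i \<le> l" "v i = w" using j Pv[of i] lenP by auto
      then show "w \<in> v ` {..l}" by auto
    qed
  qed
  have inj: "inj_on v {..l}" using cX X by (intro eq_card_imp_inj_on) auto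
  have end_l: "e \<subseteq> ?X" if "e \<in> E" "v l \<in> e" "e \<notin> ?U" for e
  proof (rule ccontr)
    assume "\<not> e \<subseteq> ?X"
    then obtain w where "w \<in> e" "w \<notin> ?X" by auto
    then have "ipath E (P @ [Inr e, Inl w])"
      using that P(1) lastP P_def by (intro ipath_snoc2[of E P "v l"]) auto
    then show False using no lenP P(1) lpathI[of E "P @ [Inr e, Inl w]" p "l + 1"] by (auto simp: P_def)
  qed
  have end_0: "e \<subseteq> ?X" if "e \<in> E" "v 0 \<in> e" "e \<notin> ?U" for e
  proof (rule ccontr)
    assume "\<not> e \<subseteq> ?X"
    then obtain w where "w \<in> e" "w \<notin> ?X" by auto
    then have "ipath E (rev P @ [Inr e, Inl w])"
      using that P(1) hdP P_def ipath_rev[of E P] by (intro ipath_snoc2[of E "rev P" "v 0"]) (auto simp: last_rev simp del: ipath_rev)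
    moreover have "hd (rev P @ [Inr e, Inl w]) = Inl (v l)" using lastP by (auto simp: hd_append hd_rev P_def split: if_splits)
    ultimately show False using no lenP lpathI[of E "rev P @ [Inr e, Inl w]" "v l" "l + 1"] by auto
  qed
  have v0l: "v 0 \<in> ?X" "v l \<in> ?X" using X by auto
  then have vK: "v 0 \<in> K" "v l \<in> K" using XK by auto
  have lpos: "l > 0"
  proof (rule ccontr)
    assume "\<not> l > 0"
    then have "l = 0" by simp
    then have X0: "?X = {v 0}" using X by auto
    have "?U = {}" using cU \<open>l = 0\<close> by auto
    have "card {e\<in>E. v 0 \<in> e} \<noteq> 0" using deg[of "v 0"] v0l XK by auto
    then obtain e where e: "e \<in> E" "v 0 \<in> e" by (metis (no_types, lifting) card.empty empty_Collect_eq)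
    then have "e \<subseteq> {v 0}" using end_0[of e] \<open>?U = {}\<close> X0 by auto
    then have "card e \<le> 1" using card_mono[of "{v 0}" e] by auto
    then show False using unif e by auto
  qed
  \<comment> \<open>These are the indices \<open>i\<close> for which an edge from \<open>v 0\<close>
    to \<open>v (i + 1)\<close> and one from \<open>v l\<close> to \<open>v i\<close> could replace
    the path edge between \<open>v i\<close> and \<open>v (i + 1)\<close>. Excluding
    \<open>v 0\<close> in \<open>B\<close> keeps the two new edges distinct; the edges through both
    ends number at most \<open>k choose (r - 2)\<close>, the last summand of the degree
    bound.\<close>
  define A where "A = {i. i < l \<and> (\<exists>e\<in>E - ?U. v 0 \<in> e \<and> v (i + 1) \<in> e)}"
  define B where "B = {i. i < l \<and> (\<exists>e\<in>E - ?U. v l \<in> e \<and> v 0 \<notin> e \<and> v i \<in> e)}"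
  have AB: "A \<subseteq> {..<l}" "B \<subseteq> {..<l}" by (auto simp: A_def B_def)
  then have finAB: "finite A" "finite B" by (auto intro: finite_subset)
  have bound: "card S \<le> (m choose (r - 1))"
    if "S \<subseteq> {e. u \<in> e \<and> e \<subseteq> insert u T \<and> card e = r}" "finite T" "card T \<le> m" for S u T
  proof -
    have "card S \<le> card {e. u \<in> e \<and> e \<subseteq> insert u T \<and> card e = r}"
      using that(1,2) by (intro card_mono) (auto intro: finite_subset[of _ "Pow (insert u T)"])
    also have "\<dots> = (card (insert u T) - 1) choose (r - 1)"
      using that(2) unif(2) by (intro card_subsets_containing) auto
    also have "\<dots> \<le> m choose (r - 1)"
      using that(2,3) by (intro binomial_right_mono) (auto simp: card_insert_if)
    finally show ?thesis .
  qed
  have cA: "card A \<ge> m + 1"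
  proof (rule ccontr)
    assume "\<not> ?thesis"
    then have "card ((\<lambda>i. v (i + 1)) ` A) \<le> m" using card_image_le[OF finAB(1), of "\<lambda>i. v (i + 1)"] by linarith
    moreover have "{e\<in>E - ?U. v 0 \<in> e} \<subseteq> {e. v 0 \<in> e \<and> e \<subseteq> insert (v 0) ((\<lambda>i. v (i + 1)) ` A) \<and> card e = r}"
    proof safe
      fix e w assume e: "e \<in> E" "Inr e \<notin> set P" "v 0 \<in> e" "w \<in> e" "w \<notin> (\<lambda>i. v (i + 1)) ` A"
      then have "w \<in> v ` {..l}" using end_0[of e] X by auto
      then obtain i where i: "i \<le> l" "w = v i" by auto
      show "w = v 0"
      proof (cases i)
        case (Suc j)
        then have "j \<in> A" using e i unfolding A_def by auto
        then show ?thesis using e(5) i Suc by auto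
      qed (use i in auto)
    qed (use unif in auto)
    ultimately have "card {e\<in>E - ?U. v 0 \<in> e} \<le> (m choose (r - 1))"
      using finAB by (intro bound) auto
    moreover have "card {e\<in>E. v 0 \<in> e} \<le> card {e\<in>E - ?U. v 0 \<in> e} + card ?U"
    proof -
      have "card {e\<in>E. v 0 \<in> e} \<le> card ({e\<in>E - ?U. v 0 \<in> e} \<union> ?U)"
        using fin by (intro card_mono) auto
      then show ?thesis using card_Un_le le_trans by blast
    qed
    ultimately show False using deg[OF vK(1)] cU l by linarith
  qed
  have cB: "card B \<ge> m + 1"
  proof (rule ccontr)
    assume "\<not> ?thesis"
    then have "card (v ` B) \<le> m" using card_image_le[OF finAB(2), of v] by linarith
    moreover have "{e\<in>E - ?U. v l \<in> e \<and> v 0 \<notin> e} \<subseteq> {e. v l \<in> e \<and> e \<subseteq> insert (v l) (v ` B) \<and> card e = r}"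
    proof safe
      fix e w assume e: "e \<in> E" "Inr e \<notin> set P" "v l \<in> e" "v 0 \<notin> e" "w \<in> e" "w \<notin> v ` B"
      then have "w \<in> v ` {..l}" using end_l[of e] X by auto
      then obtain i where i: "i \<le> l" "w = v i" by auto
      show "w = v l"
      proof (cases "i = l")
        case False
        then have "i \<in> B" using e i unfolding B_def by auto
        then show ?thesis using e(6) i by auto
      qed (use i in auto)
    qed (use unif in auto)
    ultimately have "card {e\<in>E - ?U. v l \<in> e \<and> v 0 \<notin> e} \<le> (m choose (r - 1))"
      using finAB by (intro bound) auto
    moreover have "card {e\<in>E - ?U. v l \<in> e \<and> v 0 \<in> e} \<le> (k choose (r - 2))"
    proof -
      have ne: "v 0 \<noteq> v l" using inj lpos by (auto dest: inj_onD)
      let ?S = "{e. v l \<in> e \<and> e \<subseteq> ?X - {v 0} \<and> card e = r - 1}"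
      have fS: "finite ?S" by (rule finite_subset[of _ "Pow ?X"]) auto
      have "{e\<in>E - ?U. v l \<in> e \<and> v 0 \<in> e} \<subseteq> insert (v 0) ` ?S"
      proof
        fix e assume e: "e \<in> {e\<in>E - ?U. v l \<in> e \<and> v 0 \<in> e}"
        then have "e \<subseteq> ?X" "card e = r" using end_l unif by auto
        then have "e - {v 0} \<in> ?S" using e ne by (auto simp: card_Diff_singleton finite_subset)
        moreover have "e = insert (v 0) (e - {v 0})" using e by auto
        ultimately show "e \<in> insert (v 0) ` ?S" by blast
      qed
      then have "card {e\<in>E - ?U. v l \<in> e \<and> v 0 \<in> e} \<le> card ?S"
        using fS by (meson card_image_le card_mono finite_imageI le_trans)
      also have "\<dots> = (card (?X - {v 0}) - 1) choose (r - 1 - 1)"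
        using ne v0l unif by (intro card_subsets_containing) auto
      also have "\<dots> \<le> k choose (r - 2)"
      proof -
        have "r - 1 - 1 = r - 2" by simp
        moreover have "card (?X - {v 0}) - 1 \<le> k" using cX l v0l by (simp add: card_Diff_singleton)
        ultimately show ?thesis by (metis binomial_right_mono)
      qed
      finally show ?thesis .
    qed
    moreover have "card {e\<in>E. v l \<in> e} \<le> card {e\<in>E - ?U. v l \<in> e \<and> v 0 \<notin> e} + card {e\<in>E - ?U. v l \<in> e \<and> v 0 \<in> e} + card ?U"
    proof -
      have "card {e\<in>E. v l \<in> e} \<le> card (({e\<in>E - ?U. v l \<in> e \<and> v 0 \<notin> e} \<union> {e\<in>E - ?U. v l \<in> e \<and> v 0 \<in> e}) \<union> ?U)"
        using fin by (intro card_mono) auto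
      also have "\<dots> \<le> card {e\<in>E - ?U. v l \<in> e \<and> v 0 \<notin> e} + card {e\<in>E - ?U. v l \<in> e \<and> v 0 \<in> e} + card ?U"
        by (meson add_mono card_Un_le le_trans order_refl)
      finally show ?thesis .
    qed
    ultimately show False using deg[OF vK(2)] cU l by linarith
  qed
  \<comment> \<open>There are at least \<open>m + 1\<close> indices of either kind, but only
    \<open>l \<le> 2 * m + 1\<close> positions.\<close>
  have "A \<inter> B \<noteq> {}"
  proof
    assume "A \<inter> B = {}"
    then have "card A + card B = card (A \<union> B)" using finAB by (simp add: card_Un_disjoint)
    also have "\<dots> \<le> l" using AB card_mono[of "{..<l}" "A \<union> B"] by auto
    finally show False using cA cB k l by linarith
  qed
  then obtain i e e' where i: "i < l" and e: "e \<in> E - ?U" "v 0 \<in> e" "v (i + 1) \<in> e"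
    and e': "e' \<in> E - ?U" "v l \<in> e'" "v 0 \<notin> e'" "v i \<in> e'"
    by (auto simp: A_def B_def)
  define P1 where "P1 = take (2 * i + 1) P"
  define P2 where "P2 = drop (2 * i + 2) P"
  define h where "h = P ! (2 * i + 1)"
  have Psplit: "P = P1 @ h # P2" unfolding P1_def P2_def h_def using i lenP
    using id_take_nth_drop[of "2 * i + 1" P] by simp
  have P1: "P1 \<noteq> []" "hd P1 = Inl (v 0)" "last P1 = Inl (v i)" "length P1 = 2 * i + 1"
    using hdP Pv[of i] i lenP by (auto simp: P1_def P_def last_conv_nth)
  have P2: "P2 \<noteq> []" "hd P2 = Inl (v (i + 1))" "last P2 = Inl (v l)"
    using lastP Pv[of "i + 1"] i lenP by (auto simp: P2_def hd_drop_conv_nth)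
  have hInr: "h \<noteq> Inl w" for w
    using ipath_nth[OF P0(1), of "2 * i + 1"] i lenP unfolding h_def P_def by auto
  \<comment> \<open>The cycle is \<open>e\<close>, then \<open>v 0\<close> to \<open>v i\<close>,
    then \<open>e'\<close>, then \<open>v l\<close> back to \<open>v (i + 1)\<close>, which lies in
    \<open>e\<close>. The path edge \<open>h\<close> is dropped, so there are \<open>l + 1\<close>
    vertices and \<open>l + 1\<close> edges.\<close>
  define cs where "cs = Inr e # P1 @ Inr e' # rev P2"
  have "ipath E P1" "ipath E P2" "set P1 \<inter> set P2 = {}" using P(1) Psplit by (auto simp: ipath_append ipath_Cons)
  moreover have "Inr e \<notin> set P" "Inr e' \<notin> set P" "e \<noteq> e'" using e e' by auto
  ultimately have "ipath E cs"
    using e e' P1 P2 Psplit unfolding cs_def by (auto simp: ipath_Cons ipath_append hd_rev)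
  moreover have "iadj E (last cs) (hd cs)" using e P2 by (simp add: cs_def last_rev)
  moreover have "length cs = 2 * (l + 1)"
    using lenP Psplit by (simp add: cs_def)
  moreover have csX: "Inl w \<in> set cs \<longleftrightarrow> w \<in> ?X" for w
    using Psplit hInr by (auto simp: cs_def)
  moreover obtain b where "b \<in> K" "b \<notin> ?X"
  proof -
    have "card ?X < card K" using cX l K by simp
    then have "\<not> K \<subseteq> ?X" using card_mono[of ?X K] by auto
    then show ?thesis using that by blast
  qed
  moreover obtain a b' where ab: "(a, b') \<in> link E" "a \<in> ?X" "b' \<notin> ?X"
    using rtrancl_exits[OF conn[of "v 0" b], of ?X] v0l XK \<open>b \<in> K\<close> \<open>b \<notin> ?X\<close> by blast
  moreover obtain g where "g \<in> E" "a \<in> g" "b' \<in> g" using ab(1) by (auto simp: link_def)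
  ultimately have "lpath E (l + 1)"
    by (intro cycle_extends[of E cs "l + 1" g a b']) (auto simp: cs_def)
  with no show False ..
qed

lemma dirac_path:
  assumes "finite E" "\<And>e. e \<in> E \<Longrightarrow> card e = r" "r \<ge> 2" "\<Union>E \<subseteq> K"
    and "\<And>u w. u \<in> K \<Longrightarrow> w \<in> K \<Longrightarrow> (u, w) \<in> (link E)\<^sup>*"
    and "\<And>u. u \<in> K \<Longrightarrow> (m choose (r - 1)) + k + (k choose (r - 2)) < card {e\<in>E. u \<in> e}"
    and "k \<le> 2 * m + 2" "k < card K"
  shows "lpath E k"
proof -
  have "lpath E l" if "l \<le> k" for l
    using that
  proof (induction l)
    case 0
    then show ?case by (auto simp: lpath_def)
  next
    case (Suc l)
    then show ?case using dirac_step[OF assms, of l] by simp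
  qed
  then show ?thesis by simp
qed

section \<open>Joining two components of a core\<close>

lemma sym_link: "sym (link E)"
  by (auto simp: sym_def link_def)

lemma link_rtrancl_sym: "(u, w) \<in> (link E)\<^sup>* \<Longrightarrow> (w, u) \<in> (link E)\<^sup>*"
  using sym_rtrancl[OF sym_link] by (rule symD)

lemma link_rtrancl_in: "(u, w) \<in> (link E)\<^sup>* \<Longrightarrow> u \<in> C \<Longrightarrow> \<Union>E \<subseteq> C \<Longrightarrow> w \<in> C"
  by (induction rule: rtrancl_induct) (auto simp: link_def)

text \<open>Two components of a core of high minimum degree are joined by a path avoiding the core,
  which is prolonged at both ends inside the two components.\<close>

lemma core_connected:
  assumes fin: "finite E" and unif: "\<And>e. e \<in> E \<Longrightarrow> card e = r" "r \<ge> 2"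
    and no: "\<not> lpath E k" and k: "k \<le> 2 * m + 2"
    and deg: "\<And>v. v \<in> C \<Longrightarrow> m + (m choose (r - 1)) < card {e\<in>E. e \<subseteq> C \<and> v \<in> e}"
    and conn: "\<And>u w. u \<in> C \<Longrightarrow> w \<in> C \<Longrightarrow> (u, w) \<in> (link E)\<^sup>*"
    and uw: "u \<in> C" "w \<in> C"
  shows "(u, w) \<in> (link {e\<in>E. e \<subseteq> C})\<^sup>*"
proof (rule ccontr)
  assume nuw: "(u, w) \<notin> (link {e\<in>E. e \<subseteq> C})\<^sup>*"
  let ?F = "{e\<in>E. e \<subseteq> C}"
  define comp where "comp u = {w. (u, w) \<in> (link ?F)\<^sup>*}" for u
  \<comment> \<open>A shortest path between core vertices of different components meets
    \<open>C\<close> only in its ends: an inner core vertex would lie in another component than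
    \<open>u\<close> or than \<open>w\<close> and give a shorter such path.\<close>
  define Q where "Q ys \<longleftrightarrow> (\<exists>u w. u \<in> C \<and> w \<in> C \<and> (u, w) \<notin> (link ?F)\<^sup>* \<and>
    ipath E (Inl u # ys) \<and> last (Inl u # ys) = Inl w)" for ys
  obtain ys0 where "Q ys0"
    using link_rtrancl_ipath[OF conn[OF uw]] uw nuw unfolding Q_def by blast
  then obtain ys where "Q ys" and minimal: "\<And>zs. Q zs \<Longrightarrow> length ys \<le> length zs"
    using ex_has_least_nat[of Q ys0 length] by blast
  then obtain u w where u: "u \<in> C" "w \<in> C" "(u, w) \<notin> (link ?F)\<^sup>*"
    and ys: "ipath E (Inl u # ys)" "last (Inl u # ys) = Inl w"
    unfolding Q_def by blast
  have uw_ne: "u \<noteq> w" using u by auto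
  then have "ys \<noteq> []" using ys by auto
  then have lastys: "last ys = Inl w" "Inl w \<in> set ys" using ys(2) last_in_set by fastforce+
  have interior: "z = u \<or> z = w" if z: "Inl z \<in> set (Inl u # ys)" "z \<in> C" for z
  proof (rule ccontr)
    assume ne: "\<not> (z = u \<or> z = w)"
    then have "Inl z \<in> set ys" using z by auto
    then obtain as bs where ab: "ys = as @ Inl z # bs" by (metis split_list)
    have bs: "bs \<noteq> []" using lastys ab ne by auto
    have "ipath E ((Inl u # as @ [Inl z]) @ bs)" using ys ab by simp
    then have 1: "ipath E (Inl u # as @ [Inl z])" by (simp only: ipath_append)
    have "ipath E ((Inl u # as) @ (Inl z # bs))" using ys ab by simp
    then have 2: "ipath E (Inl z # bs)" by (simp only: ipath_append)
    consider "(u, z) \<notin> (link ?F)\<^sup>*" | "(z, w) \<notin> (link ?F)\<^sup>*" using u(3) by (meson rtrancl_trans)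
    then show False
    proof cases
      case 1
      then have "Q (as @ [Inl z])" unfolding Q_def using \<open>ipath E (Inl u # as @ [Inl z])\<close> u z by auto
      from minimal[OF this] show False using ab bs by (cases bs) auto
    next
      case 2
      then have "Q bs" unfolding Q_def using \<open>ipath E (Inl z # bs)\<close> u z bs lastys ab by auto
      from minimal[OF this] show False using ab by auto
    qed
  qed
  \<comment> \<open>Both path neighbours of a core edge lie in \<open>C\<close>, so they would be
    \<open>u\<close> and \<open>w\<close>, and the edge would link their components.\<close>
  have no_core_edge: "g \<notin> ?F" if g: "Inr g \<in> set (Inl u # ys)" for g
  proof
    assume gF: "g \<in> ?F"
    obtain as bs where ab: "Inl u # ys = as @ Inr g # bs" using g by (metis split_list)
    have as: "as \<noteq> []" using ab by (cases as) auto
    have bs: "bs \<noteq> []" using ab ys(2) by (cases bs) auto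
    have "ipath E (as @ Inr g # bs)" using ys ab by simp
    then have adj: "iadj E (last as) (Inr g)" "iadj E (Inr g) (hd bs)" "set as \<inter> set bs = {}"
      using as bs by (auto simp: ipath_append ipath_Cons)
    obtain a where a: "last as = Inl a" "a \<in> g" using adj(1) by (cases "last as") auto
    obtain b where b: "hd bs = Inl b" "b \<in> g" using adj(2) by (cases "hd bs") auto
    have in_sets: "Inl a \<in> set as" "Inl b \<in> set bs" using a b as bs by (metis last_in_set, metis hd_in_set)
    then have "a \<noteq> b" using adj by auto
    have "a = u \<or> a = w" "b = u \<or> b = w"
      using interior[of a] interior[of b] in_sets a b gF ab by auto
    with \<open>a \<noteq> b\<close> have "u \<in> g" "w \<in> g" using a b by auto
    then have "(u, w) \<in> link ?F" using gF by (auto simp: link_def)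
    then show False using u by auto
  qed
  have ends: "\<exists>xs. ipath ?F (Inl v # xs) \<and> length xs = 2 * (m + 1) \<and> path_verts (Inl v # xs) \<subseteq> comp v
      \<and> path_edges xs \<subseteq> {e\<in>?F. e \<subseteq> comp v}"
    if v: "v \<in> C" for v
  proof -
    \<comment> \<open>Restricting to edges inside the component costs no degree, and it keeps the
      final segments grown in the two components disjoint.\<close>
    let ?G = "{e\<in>?F. e \<subseteq> comp v}"
    have deg': "m + (m choose (r - 1)) < card {e\<in>?G. z \<in> e}" if z: "z \<in> comp v" for z
    proof -
      have "z \<in> C" using z v link_rtrancl_in[of v z ?F C] by (auto simp: comp_def)
      moreover have "{e\<in>?G. z \<in> e} = {e\<in>E. e \<subseteq> C \<and> z \<in> e}"
      proof -
        have "e \<subseteq> comp v" if "e \<in> ?F" "z \<in> e" for e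
        proof
          fix y assume "y \<in> e"
          then have "(z, y) \<in> link ?F" using that by (auto simp: link_def)
          then show "y \<in> comp v" using z unfolding comp_def by (auto intro: rtrancl_into_rtrancl)
        qed
        then show ?thesis by auto
      qed
      ultimately show ?thesis using deg by simp
    qed
    have "\<exists>xs. ipath ?G (Inl v # xs) \<and> length xs = 2 * (m + 1)"
      using fin unif deg' by (intro long_ipath_from[where s = r and C = "comp v" and m = m]) (auto simp: comp_def)
    then obtain xs where xs: "ipath ?G (Inl v # xs)" "length xs = 2 * (m + 1)" by blast
    have "path_verts (Inl v # xs) \<subseteq> comp v"
      using ipath_verts_subset[OF xs(1)] by (auto simp: comp_def)
    moreover have "path_edges xs \<subseteq> ?G" using ipath_edges_subset[OF xs(1)] by auto
    moreover have "ipath ?F (Inl v # xs)" using xs(1) by (rule ipath_mono) auto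
    ultimately show ?thesis using xs by blast
  qed
  obtain xu where xu: "ipath ?F (Inl u # xu)" "length xu = 2 * (m + 1)"
    "path_verts (Inl u # xu) \<subseteq> comp u" "path_edges xu \<subseteq> {e\<in>?F. e \<subseteq> comp u}" using ends[OF u(1)] by blast
  obtain xw where xw: "ipath ?F (Inl w # xw)" "length xw = 2 * (m + 1)"
    "path_verts (Inl w # xw) \<subseteq> comp w" "path_edges xw \<subseteq> {e\<in>?F. e \<subseteq> comp w}" using ends[OF u(2)] by blast
  have disj: "comp u \<inter> comp w = {}"
    using u(3) unfolding comp_def by (auto dest: link_rtrancl_sym intro: rtrancl_trans)
  have compC: "comp u \<subseteq> C" "comp w \<subseteq> C"
    using u link_rtrancl_in[of _ _ ?F C] by (auto simp: comp_def)
  have ne: "e \<noteq> {}" if "e \<in> E" for e using unif that by force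
  have d1: "set xu \<inter> set (Inl u # ys) = {}"
  proof -
    have "x \<notin> set (Inl u # ys)" if x: "x \<in> set xu" for x
    proof (cases x)
      case (Inl z)
      then have "z \<in> comp u" "z \<in> C" using x xu(3) compC by auto
      moreover have "z \<noteq> u" using xu(1) x Inl by (auto simp: ipath_Cons)
      moreover have "z \<noteq> w" using disj \<open>z \<in> comp u\<close> by (auto simp: comp_def)
      ultimately show ?thesis using interior Inl by blast
    next
      case (Inr g)
      then show ?thesis using no_core_edge[of g] x xu(4) by blast
    qed
    then show ?thesis by blast
  qed
  have d2: "set xw \<inter> set (Inl u # ys) = {}"
  proof -
    have "x \<notin> set (Inl u # ys)" if x: "x \<in> set xw" for x
    proof (cases x)
      case (Inl z)
      then have "z \<in> comp w" "z \<in> C" using x xw(3) compC by auto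
      moreover have "z \<noteq> w" using xw(1) x Inl by (auto simp: ipath_Cons)
      moreover have "z \<noteq> u" using disj \<open>z \<in> comp w\<close> by (auto simp: comp_def)
      ultimately show ?thesis using interior Inl by blast
    next
      case (Inr g)
      then show ?thesis using no_core_edge[of g] x xw(4) by blast
    qed
    then show ?thesis by blast
  qed
  have d3: "set xu \<inter> set xw = {}"
  proof -
    have "x \<notin> set xw" if x: "x \<in> set xu" for x
    proof (cases x)
      case (Inl z)
      then show ?thesis using x xu(3) xw(3) disj by auto
    next
      case (Inr g)
      then have "g \<subseteq> comp u" "g \<noteq> {}" using x xu(4) ne by auto
      then show ?thesis using Inr xw(4) disj by blast
    qed
    then show ?thesis by blast
  qed
  have ixu: "ipath E (Inl u # xu)" and ixw: "ipath E (Inl w # xw)"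
    using xu(1) xw(1) by (auto intro: ipath_mono)
  have ne': "xu \<noteq> []" "xw \<noteq> []" using xu xw by auto
  have 1: "ipath E (rev xu @ Inl u # ys)"
  proof -
    have "ipath E (rev xu)" "iadj E (Inl u) (hd xu)" using ixu ne' by (auto simp: ipath_Cons)
    then show ?thesis using ys d1 iadj_sym[of E "hd xu"] ne' by (subst ipath_append) (auto simp: last_rev)
  qed
  have 2: "ipath E ((rev xu @ Inl u # ys) @ xw)"
  proof (subst ipath_append, intro conjI)
    show "ipath E xw" using ixw by (simp add: ipath_Cons)
    show "set (rev xu @ Inl u # ys) \<inter> set xw = {}" using d2 d3 by auto
    show "rev xu @ Inl u # ys = [] \<or> xw = [] \<or> iadj E (last (rev xu @ Inl u # ys)) (hd xw)"
      using ixw ne' ys(2) by (auto simp: ipath_Cons)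
  qed (rule 1)
  \<comment> \<open>The two final segments alone have \<open>2 * (m + 1) \<ge> k\<close>
    edges.\<close>
  have "lpath E k"
  proof (rule lpathI'[OF 2])
    obtain j where "length ys = Suc j" using \<open>ys \<noteq> []\<close> by (cases ys) auto
    then have "2 * k + 1 < length xu + length ys + length xw + 1" using xu(2) xw(2) k by simp
    then show "2 * k + 1 < length ((rev xu @ Inl u # ys) @ xw)" by simp
  qed
  with no show False ..
qed

text \<open>Degrees above \<open>?D\<close> suffice both for \<open>core_connected\<close> and for
  \<open>dirac_path\<close>, so a core with more than \<open>k\<close> vertices would contain a path
  of length \<open>k\<close>. A smaller core has at most \<open>2 ^ k\<close> edges, a constant with
  respect to \<open>card V\<close>.\<close>

lemma edges_le_of_no_path:
  assumes fin: "finite V" "finite E" and unif: "\<And>e. e \<in> E \<Longrightarrow> card e = r" "r \<ge> 2"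
    and sub: "\<Union>E \<subseteq> V"
    and conn: "\<And>u w. u \<in> V \<Longrightarrow> w \<in> V \<Longrightarrow> (u, w) \<in> (link E)\<^sup>*"
    and no: "\<not> lpath E k" and k: "k \<le> 2 * m + 2" "m \<le> k"
  shows "card E \<le> ((m choose (r - 1)) + k + (k choose (r - 2))) * card V + 2 ^ k"
proof -
  let ?D = "(m choose (r - 1)) + k + (k choose (r - 2))"
  obtain C where C: "C \<subseteq> V" "\<And>v. v \<in> C \<Longrightarrow> ?D < card {e\<in>E. e \<subseteq> C \<and> v \<in> e}"
    "card E \<le> ?D * card (V - C) + card {e\<in>E. e \<subseteq> C}"
    using exists_core[OF fin sub, of ?D] by blast
  have finC: "finite C" using C(1) fin finite_subset by blast
  let ?F = "{e\<in>E. e \<subseteq> C}"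
  have "card C \<le> k"
  proof (rule ccontr)
    assume big: "\<not> card C \<le> k"
    have "m + (m choose (r - 1)) < card {e\<in>E. e \<subseteq> C \<and> v \<in> e}" if "v \<in> C" for v
      using C(2)[OF that] k by linarith
    then have "(u, w) \<in> (link ?F)\<^sup>*" if "u \<in> C" "w \<in> C" for u w
      using that conn C(1) by (intro core_connected[OF fin(2) unif no k(1)]) blast+
    moreover have "{e\<in>?F. v \<in> e} = {e\<in>E. e \<subseteq> C \<and> v \<in> e}" for v by auto
    ultimately have "lpath ?F k"
      using big fin unif C(2) k by (intro dirac_path[where K = C and r = r and m = m]) auto
    then show False using no lpath_mono[of ?F k E] by auto
  qed
  have "card ?F \<le> card (Pow C)" using finC by (intro card_mono) auto
  also have "\<dots> \<le> 2 ^ k" using \<open>card C \<le> k\<close> finC by (simp add: card_Pow)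
  finally have "card ?F \<le> 2 ^ k" .
  moreover have "?D * card (V - C) \<le> ?D * card V" using fin by (intro mult_left_mono card_mono) auto
  ultimately show ?thesis using C(3) by linarith
qed

section \<open>The lower bound\<close>

definition bipartite_edges :: "nat \<Rightarrow> 'a set \<Rightarrow> 'a set \<Rightarrow> 'a set set" where
  "bipartite_edges r S T = (\<lambda>(x, B). insert x B) ` (T \<times> {B. B \<subseteq> S \<and> card B = r - 1})"

lemma card_bipartite_edges:
  assumes "finite S" "finite T" "S \<inter> T = {}"
  shows "card (bipartite_edges r S T) = (card S choose (r - 1)) * card T"
proof -
  have "inj_on (\<lambda>(x, B). insert x B) (T \<times> {B. B \<subseteq> S \<and> card B = r - 1})"
  proof (rule inj_onI, clarify)
    fix x B y B' assume a: "x \<in> T" "y \<in> T" "B \<subseteq> S" "B' \<subseteq> S" "insert x B = insert y B'"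
    have "insert x B \<inter> S = B" "insert y B' \<inter> S = B'" using a(1-4) assms(3) by auto
    then have "B = B'" using a(5) by simp
    moreover have "insert x B \<inter> T = {x}" "insert y B' \<inter> T = {y}" using a(1-4) assms(3) by auto
    ultimately show "x = y \<and> B = B'" using a(5) by (metis the_elem_eq)
  qed
  then show ?thesis unfolding bipartite_edges_def
    using assms n_subsets[of S "r - 1"] by (simp add: card_image card_cartesian_product)
qed

text \<open>Every edge has only one vertex outside \<open>S\<close>, so no two consecutive path
  vertices avoid \<open>S\<close>. The extra summand for a start in \<open>S\<close> carries this
  through the induction.\<close>

lemma bipartite_path_visits:
  assumes "finite S" "S \<inter> T = {}"
  shows "ipath (bipartite_edges r S T) (Inl v # xs) \<Longrightarrow> length xs = 2 * l \<Longrightarrow>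
    l + (if v \<in> S then 1 else 0) \<le> 2 * card (path_verts (Inl v # xs) \<inter> S)"
proof (induction l arbitrary: v xs)
  case 0
  then show ?case by auto
next
  case (Suc l)
  then obtain x y ys where xs: "xs = x # y # ys" by (metis length_Suc_conv mult_Suc_right add_2_eq_Suc)
  from Suc.prems xs obtain e where e: "x = Inr e" by (cases x) (auto simp: ipath_Cons)
  from Suc.prems xs e obtain w where w: "y = Inl w" by (cases y) (auto simp: ipath_Cons)
  have p: "ipath (bipartite_edges r S T) (Inl w # ys)" "length ys = 2 * l"
    using Suc.prems xs e w by (auto simp: ipath_Cons)
  note IH = Suc.IH[OF p]
  have vw: "v \<in> e" "w \<in> e" "v \<noteq> w" "e \<in> bipartite_edges r S T"
    using Suc.prems xs e w by (auto simp: ipath_Cons)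
  have eq: "path_verts (Inl v # xs) = insert v (path_verts (Inl w # ys))" using xs e w by auto
  show ?case
  proof (cases "v \<in> S")
    case True
    have "v \<notin> path_verts (Inl w # ys)" using Suc.prems xs e w by (auto simp: ipath_Cons)
    then have "card (path_verts (Inl v # xs) \<inter> S) = Suc (card (path_verts (Inl w # ys) \<inter> S))"
      unfolding eq using True assms by (subst Int_insert_left_if1) (auto simp del: set_simps)
    then show ?thesis using IH True by simp
  next
    case False
    then have "w \<in> S" using vw unfolding bipartite_edges_def by auto
    moreover have "path_verts (Inl v # xs) \<inter> S = path_verts (Inl w # ys) \<inter> S"
      unfolding eq using False by auto
    ultimately show ?thesis using IH False by simp
  qed
qed

lemma bipartite_no_lpath:
  assumes "finite S" "S \<inter> T = {}" "2 * card S + 1 \<le> k"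
  shows "\<not> lpath (bipartite_edges r S T) k"
proof
  assume "lpath (bipartite_edges r S T) k"
  then obtain v xs where xs: "ipath (bipartite_edges r S T) (Inl v # xs)" "length xs = 2 * k"
    by (auto simp: lpath_def)
  have "card (path_verts (Inl v # xs) \<inter> S) \<le> card S" using assms(1) by (intro card_mono) auto
  then show False using bipartite_path_visits[OF assms(1,2) xs] assms(3) by (auto split: if_splits)
qed

text \<open>With at least \<open>r - 1\<close> fixed vertices, every fixed vertex shares an edge
  with every other one outside the fixed set; both sides are nonempty, which gives
  connectedness.\<close>

lemma exists_admissible_bipartite:
  fixes n k r s :: nat
  assumes inf: "infinite (UNIV :: 'a set)" and r: "r \<ge> 2" "r - 1 \<le> s" and k: "2 * s + 1 \<le> k" and n: "s < n"
  shows "\<exists>G :: 'a hypergraph. admissible r n k G \<and> card (edges G) = (s choose (r - 1)) * (n - s)"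
proof -
  obtain V :: "'a set" where V: "finite V" "card V = n"
    using infinite_arbitrarily_large[OF inf] by blast
  obtain S where S: "S \<subseteq> V" "card S = s" using obtain_subset_with_card_n[of s V] V n by auto
  let ?T = "V - S"
  let ?E = "bipartite_edges r S ?T"
  let ?G = "\<lparr>verts = V, edges = ?E\<rparr>"
  have finS: "finite S" using S V finite_subset by blast
  have T: "card ?T = n - s" "finite ?T" using S V finS by (auto simp: card_Diff_subset)
  have unif: "e \<subseteq> V \<and> card e = r" if "e \<in> ?E" for e
  proof -
    from that obtain x B where xB: "e = insert x B" "x \<in> ?T" "B \<subseteq> S" "card B = r - 1"
      unfolding bipartite_edges_def by auto
    then have "x \<notin> B" "finite B" using finS finite_subset by auto
    then show ?thesis using xB r S by auto
  qed
  have "r \<ge> 1" using r by simp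
  have ln: "(x, z) \<in> link ?E" if x: "x \<in> ?T" and z: "z \<in> S" for x z
  proof -
    obtain B where B: "B \<subseteq> S - {z}" "card B = r - 2"
    proof -
      have "r - 2 \<le> card (S - {z})" using z r S by (simp add: card_Diff_singleton)
      then show ?thesis using obtain_subset_with_card_n that by blast
    qed
    have "finite B" "z \<notin> B" using B finS finite_subset by auto
    then have "card (insert z B) = r - 1" using B r by simp
    then have "insert x (insert z B) \<in> ?E" unfolding bipartite_edges_def using x z B
      by (intro image_eqI[of _ _ "(x, insert z B)"]) auto
    then show ?thesis by (auto simp: link_def)
  qed
  have sym: "(z, x) \<in> link ?E" if "(x, z) \<in> link ?E" for x z using that by (auto simp: link_def)
  have "?T \<noteq> {}" "S \<noteq> {}" using T n S r by auto
  then obtain x0 z0 where x0: "x0 \<in> ?T" "z0 \<in> S" by blast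
  have to: "(v, x0) \<in> (link ?E)\<^sup>*" "(x0, v) \<in> (link ?E)\<^sup>*" if v: "v \<in> V" for v
  proof -
    have "(v, x0) \<in> (link ?E)\<^sup>* \<and> (x0, v) \<in> (link ?E)\<^sup>*"
    proof (cases "v \<in> S")
      case True
      then show ?thesis using ln[OF x0(1)] sym by blast
    next
      case False
      then have "(v, z0) \<in> link ?E" "(z0, x0) \<in> link ?E" "(z0, v) \<in> link ?E" "(x0, z0) \<in> link ?E"
        using ln x0 sym v by blast+
      then show ?thesis by (meson converse_rtrancl_into_rtrancl r_into_rtrancl)
    qed
    then show "(v, x0) \<in> (link ?E)\<^sup>*" "(x0, v) \<in> (link ?E)\<^sup>*" by auto
  qed
  have "connected_hypergraph ?G"
  proof (subst connected_hypergraph_iff_link)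
    show "\<forall>v\<in>verts ?G. \<forall>w\<in>verts ?G. (v, w) \<in> (link (edges ?G))\<^sup>*"
      using to by (metis hypergraph.select_convs rtrancl_trans)
  qed (use unif in auto)
  moreover have "\<not> has_berge_path_of_length ?G k"
    using unif bipartite_no_lpath[of S ?T k r] finS k S
    by (subst has_berge_path_iff_lpath) auto
  ultimately have "admissible r n k ?G"
    unfolding admissible_def uniform_hypergraph_def using V unif by auto
  moreover have "card (edges ?G) = (s choose (r - 1)) * (n - s)"
    using card_bipartite_edges[of S ?T r] finS T S by auto
  ultimately show ?thesis by blast
qed

section \<open>Patterns and their copies\<close>

text \<open>Injectivity is asked only on the part \<open>W\<close> met by the path: in
  \<open>no_lpath_pump\<close> infinitely many copies face only \<open>k\<close> embeddings, and
  just the copies used by the path can be kept apart.\<close>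

lemma lpath_image:
  assumes P: "ipath E (Inl v # xs)" "length xs = 2 * k"
    and W: "\<And>w. Inl w \<in> set (Inl v # xs) \<Longrightarrow> w \<in> W" "\<And>e. Inr e \<in> set xs \<Longrightarrow> e \<subseteq> W \<and> f ` e \<in> E'"
    and inj: "inj_on f W"
  shows "lpath E' k"
proof -
  let ?P = "Inl v # xs" and ?f = "map_sum f ((`) f)"
  have "inj_on ?f (set ?P)"
  proof (rule inj_onI)
    fix x y assume xy: "x \<in> set ?P" "y \<in> set ?P" "?f x = ?f y"
    show "x = y"
    proof (cases x; cases y)
      fix a b assume "x = Inl a" "y = Inl b"
      then show ?thesis using xy W(1)[of a] W(1)[of b] inj by (auto dest: inj_onD)
    next
      fix a b assume ab: "x = Inr a" "y = Inr b"
      then have "a \<subseteq> W" "b \<subseteq> W" "f ` a = f ` b" using xy W(2)[of a] W(2)[of b] by auto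
      then show ?thesis using ab inj by (simp add: inj_on_image_eq_iff)
    qed (use xy in auto)
  qed
  moreover have "successively (iadj E') (map ?f ?P)"
    unfolding successively_map
  proof (rule successively_mono)
    show "successively (iadj E) ?P" using P by (simp add: ipath_def)
    fix x y assume xy: "x \<in> set ?P" "y \<in> set ?P" "iadj E x y"
    show "iadj E' (?f x) (?f y)" by (insert xy W(2); cases x; cases y; auto)
  qed
  ultimately have "ipath E' (Inl (f v) # map ?f xs)" using P by (simp add: ipath_def distinct_map)
  then show ?thesis using P(2) unfolding lpath_def by (metis length_map)
qed

text \<open>A Berge path only requires each edge to contain two consecutive vertices, so it survives
  an enlargement of its edges that keeps them distinct. Thus the absence of long paths passes to
  edges from which a vertex was removed.\<close>

lemma lpath_lift:
  assumes "lpath G k" "inj_on L G" "\<And>g. g \<in> G \<Longrightarrow> g \<subseteq> L g \<and> L g \<in> E"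
  shows "lpath E k"
proof -
  obtain v xs where P: "ipath G (Inl v # xs)" "length xs = 2 * k" using assms(1) by (auto simp: lpath_def)
  let ?P = "Inl v # xs" and ?f = "map_sum id L"
  have G: "path_edges ?P \<subseteq> G" using ipath_edges_subset[OF P(1)] .
  have "inj_on ?f (set ?P)"
  proof (rule inj_onI)
    fix x y assume xy: "x \<in> set ?P" "y \<in> set ?P" "?f x = ?f y"
    show "x = y" by (insert xy G assms(2); cases x; cases y; auto dest: inj_onD)
  qed
  moreover have "successively (iadj E) (map ?f ?P)"
    unfolding successively_map
  proof (rule successively_mono)
    show "successively (iadj G) ?P" using P by (simp add: ipath_def)
    fix x y assume xy: "x \<in> set ?P" "y \<in> set ?P" "iadj G x y"
    show "iadj E (?f x) (?f y)" by (insert xy assms(3); cases x; cases y; auto)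
  qed
  ultimately have "ipath E (Inl v # map ?f xs)" using P by (simp add: ipath_def distinct_map)
  then show ?thesis using P(2) unfolding lpath_def by (metis length_map)
qed

text \<open>A pattern \<open>(A, F)\<close> is a piece \<open>A\<close> of a hypergraph together with all edges meeting it; the
  vertices in \<open>\<Union>F - A\<close> are those to which the piece is attached.\<close>

definition pattern :: "nat \<Rightarrow> 'b set \<Rightarrow> 'b set set \<Rightarrow> bool" where
  "pattern r A F \<longleftrightarrow> finite A \<and> finite F \<and> A \<noteq> {} \<and> (\<forall>e\<in>F. card e = r \<and> e \<inter> A \<noteq> {}) \<and>
     (\<forall>u\<in>A. \<forall>w\<in>A. (u, w) \<in> (link F \<inter> A \<times> A)\<^sup>*) \<and> (\<exists>e\<in>F. \<not> e \<subseteq> A)"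

text \<open>A sunflower of \<open>k\<close> copies of the pattern in \<open>E\<close>: the copies of
  \<open>A\<close> are the pairwise disjoint petals, and the attachment vertices form the kernel on
  which all embeddings agree.\<close>

definition realized :: "nat \<Rightarrow> 'a set set \<Rightarrow> 'b set \<Rightarrow> 'b set set \<Rightarrow> bool" where
  "realized k E A F \<longleftrightarrow> (\<exists>\<theta> :: nat \<Rightarrow> 'b \<Rightarrow> 'a. \<forall>i<k. inj_on (\<theta> i) (A \<union> \<Union>F) \<and> (\<forall>e\<in>F. \<theta> i ` e \<in> E) \<and>
     (\<forall>j<k. (\<forall>s\<in>\<Union>F - A. \<theta> i s = \<theta> j s) \<and> (i \<noteq> j \<longrightarrow> \<theta> i ` A \<inter> \<theta> j ` A = {})))"

text \<open>Attachment vertices get index 0 in every copy, so that all copies share them; the second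
  component distinguishes them from copy 0 of \<open>A\<close>.\<close>

definition copy :: "'b set \<Rightarrow> nat \<Rightarrow> 'b \<Rightarrow> nat \<times> 'b" where
  "copy A j v = (if v \<in> A then (j, v) else (0, v))"

text \<open>All infinitely many copies at once; the hypergraphs built later take finitely many of
  these edges and inherit the absence of long paths.\<close>

definition pump :: "'b set \<Rightarrow> 'b set set \<Rightarrow> (nat \<times> 'b) set set" where
  "pump A F = {copy A j ` e | j e. e \<in> F}"

lemma inj_copy: "inj (copy A j)"
  by (auto simp: inj_def copy_def split: if_splits)

lemma copy_image_eq:
  assumes "copy A i ` e = copy A j ` f" "e \<inter> A \<noteq> {}"
  shows "i = j \<and> e = f"
proof -
  obtain v where v: "v \<in> e" "v \<in> A" using assms by auto
  then have "copy A i v \<in> copy A j ` f" using assms(1) by auto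
  then have "i = j" using v by (auto simp: copy_def split: if_splits)
  then show ?thesis using assms(1) inj_image_eq_iff[OF inj_copy] by metis
qed

text \<open>The at most \<open>k\<close> copies used by a path with \<open>k\<close> edges are sent
  to distinct embeddings; on the kernel all embeddings coincide, so the path is mapped consistently
  into \<open>E\<close>.\<close>

lemma no_lpath_pump:
  fixes A :: "'b set" and E :: "'a set set"
  assumes real: "realized k E A F" and no: "\<not> lpath E k" and k: "k \<ge> 1"
  shows "\<not> lpath (pump A F) k"
proof
  assume "lpath (pump A F) k"
  then obtain v xs where P: "ipath (pump A F) (Inl v # xs)" "length xs = 2 * k" by (auto simp: lpath_def)
  obtain \<theta> :: "nat \<Rightarrow> 'b \<Rightarrow> 'a" where "\<forall>i<k. inj_on (\<theta> i) (A \<union> \<Union>F) \<and> (\<forall>e\<in>F. \<theta> i ` e \<in> E) \<and>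
     (\<forall>j<k. (\<forall>s\<in>\<Union>F - A. \<theta> i s = \<theta> j s) \<and> (i \<noteq> j \<longrightarrow> \<theta> i ` A \<inter> \<theta> j ` A = {}))"
    using real unfolding realized_def by blast
  then have \<theta>: "\<And>i. i < k \<Longrightarrow> inj_on (\<theta> i) (A \<union> \<Union>F)" "\<And>i e. i < k \<Longrightarrow> e \<in> F \<Longrightarrow> \<theta> i ` e \<in> E"
     "\<And>i j s. i < k \<Longrightarrow> j < k \<Longrightarrow> s \<in> \<Union>F - A \<Longrightarrow> \<theta> i s = \<theta> j s"
     "\<And>i j. i < k \<Longrightarrow> j < k \<Longrightarrow> i \<noteq> j \<Longrightarrow> \<theta> i ` A \<inter> \<theta> j ` A = {}"
    by blast+
  have pe: "path_edges xs \<subseteq> pump A F" using ipath_edges_subset[OF P(1)] by auto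
  then have "\<forall>h\<in>path_edges xs. \<exists>j e. h = copy A j ` e \<and> e \<in> F" by (auto simp: pump_def)
  then obtain J ed where Je: "\<And>h. h \<in> path_edges xs \<Longrightarrow> h = copy A (J h) ` ed h \<and> ed h \<in> F" by metis
  let ?T = "J ` path_edges xs"
  have "card (path_edges xs) = k" using ipath_cards[OF P] by auto
  then have cT: "card ?T \<le> k" by (metis card_image_le finite_path_sets(2))
  obtain \<sigma> where \<sigma>: "inj_on \<sigma> ?T" "\<sigma> ` ?T \<subseteq> {..<k}"
    using card_le_inj[of ?T "{..<k}"] cT by auto
  have \<sigma>k: "\<sigma> j < k" if "j \<in> ?T" for j using \<sigma> that by auto
  define \<Phi> where "\<Phi> = (\<lambda>(j, v). if v \<in> A then \<theta> (\<sigma> j) v else \<theta> 0 v)"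
  define W where "W = {(j, v). j \<in> ?T \<and> v \<in> A} \<union> {(0, v) | v. v \<in> \<Union>F - A}"
  have k0: "0 < k" using k by simp
  have inj: "inj_on \<Phi> W"
  proof (rule inj_onI)
    fix x y assume xy: "x \<in> W" "y \<in> W" "\<Phi> x = \<Phi> y"
    obtain i u j w where x: "x = (i, u)" and y: "y = (j, w)" by (metis surj_pair)
    have AS: "\<theta> (\<sigma> i) u \<noteq> \<theta> 0 w" if "i \<in> ?T" "u \<in> A" "w \<in> \<Union>F - A" for i u w
    proof
      assume "\<theta> (\<sigma> i) u = \<theta> 0 w"
      then have "\<theta> (\<sigma> i) u = \<theta> (\<sigma> i) w" using \<theta>(3)[OF \<sigma>k[OF that(1)] k0 that(3)] by simp
      then have "u = w" using \<theta>(1)[OF \<sigma>k[OF that(1)]] that by (auto dest: inj_onD)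
      then show False using that by auto
    qed
    consider "u \<in> A" "w \<in> A" | "u \<in> A" "w \<notin> A" | "u \<notin> A" "w \<in> A" | "u \<notin> A" "w \<notin> A" by blast
    then show "x = y"
    proof cases
      case 1
      then have ij: "i \<in> ?T" "j \<in> ?T" "\<theta> (\<sigma> i) u = \<theta> (\<sigma> j) w" using xy x y by (auto simp: W_def \<Phi>_def)
      have "\<sigma> i = \<sigma> j"
      proof (rule ccontr)
        assume "\<sigma> i \<noteq> \<sigma> j"
        then have "\<theta> (\<sigma> i) ` A \<inter> \<theta> (\<sigma> j) ` A = {}" using \<theta>(4) \<sigma>k ij by blast
        then show False using ij 1 by (metis IntI empty_iff imageI)
      qed
      then have "i = j" using \<sigma>(1) ij by (auto dest: inj_onD)
      moreover have "u = w" using \<theta>(1)[OF \<sigma>k[OF ij(1)]] ij 1 \<open>\<sigma> i = \<sigma> j\<close> by (auto dest: inj_onD)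
      ultimately show ?thesis using x y by simp
    next
      case 2
      then show ?thesis using xy x y AS[of i u w] by (auto simp: W_def \<Phi>_def)
    next
      case 3
      then show ?thesis using xy x y AS[of j w u] by (auto simp: W_def \<Phi>_def)
    next
      case 4
      then have "u \<in> \<Union>F - A" "w \<in> \<Union>F - A" "i = 0" "j = 0" "\<theta> 0 u = \<theta> 0 w"
        using xy x y by (auto simp: W_def \<Phi>_def)
      then show ?thesis using \<theta>(1)[OF k0] x y by (auto dest: inj_onD)
    qed
  qed
  have ed: "h \<subseteq> W \<and> \<Phi> ` h \<in> E" if h: "Inr h \<in> set xs" for h
  proof -
    have h': "h = copy A (J h) ` ed h" "ed h \<in> F" "J h \<in> ?T" using Je[of h] h by auto
    have "copy A (J h) ` ed h \<subseteq> W" using h'(2,3) unfolding W_def copy_def by auto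
    then have hW: "h \<subseteq> W" by (subst h'(1))
    have "\<Phi> (copy A (J h) v) = \<theta> (\<sigma> (J h)) v" if "v \<in> ed h" for v
    proof (cases "v \<in> A")
      case False
      then show ?thesis using \<theta>(3)[OF k0 \<sigma>k[OF h'(3)], of v] that h'(2) by (auto simp: \<Phi>_def copy_def)
    qed (simp add: \<Phi>_def copy_def)
    then have "\<Phi> ` copy A (J h) ` ed h = \<theta> (\<sigma> (J h)) ` ed h" unfolding image_image by (rule image_cong[OF refl])
    then have "\<Phi> ` h = \<theta> (\<sigma> (J h)) ` ed h" by (subst h'(1))
    then show ?thesis using hW \<theta>(2)[OF \<sigma>k[OF h'(3)] h'(2)] by metis
  qed
  \<comment> \<open>Since \<open>k \<ge> 1\<close>, every path vertex lies on a path edge.\<close>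
  have vw: "w \<in> W" if w: "Inl w \<in> set (Inl v # xs)" for w
  proof -
    have "successively (iadj (path_edges xs)) (Inl v # xs)"
    proof (rule successively_mono)
      show "successively (iadj (pump A F)) (Inl v # xs)" using P(1) by (simp add: ipath_def)
      fix x y assume xy: "x \<in> set (Inl v # xs)" "y \<in> set (Inl v # xs)" "iadj (pump A F) x y"
      show "iadj (path_edges xs) x y" by (insert xy; cases x; cases y; auto)
    qed
    then have "ipath (path_edges xs) (Inl v # xs)" using P(1) by (simp add: ipath_def)
    note Q = ipath_verts_subset[OF this]
    obtain y ys where ys: "xs = y # ys" using P k by (cases xs) auto
    then obtain h where "y = Inr h" "v \<in> h" using P by (cases y) (auto simp: ipath_Cons)
    then have "v \<in> \<Union>(path_edges xs)" using ys by auto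
    with Q have "w \<in> \<Union>(path_edges xs)" using w by blast
    then show ?thesis using ed by blast
  qed
  have "lpath E k" using P vw ed inj by (rule lpath_image)
  with no show False ..
qed

section \<open>Growing a piece edge by edge\<close>

text \<open>These are the vertex sets allowed for partial copies. A new edge contains an attachment
  vertex or a vertex already present, so every vertex of \<open>B\<close> remains joined to an
  attachment vertex by edges whose part in \<open>A\<close> lies in \<open>B\<close>.\<close>

inductive reach :: "'b set \<Rightarrow> 'b set set \<Rightarrow> 'b set \<Rightarrow> bool" for A F where
  reach_empty: "reach A F {}"
| reach_step: "reach A F B \<Longrightarrow> e \<in> F \<Longrightarrow> \<not> e \<subseteq> A - B \<Longrightarrow> reach A F (B \<union> (e \<inter> A))"

lemma reach_subset: "reach A F B \<Longrightarrow> B \<subseteq> A"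
  by (induction rule: reach.induct) auto

text \<open>A largest reachable set is closed under edges with a vertex in it or outside
  \<open>A\<close>. An edge not inside \<open>A\<close> makes it nonempty, and the connectivity of
  \<open>A\<close> does the rest.\<close>

lemma reach_all:
  assumes "pattern r A F"
  shows "reach A F A"
proof -
  have fin: "finite A" and F: "\<And>e. e \<in> F \<Longrightarrow> e \<inter> A \<noteq> {}" "\<exists>e\<in>F. \<not> e \<subseteq> A"
    and conn: "\<And>u w. u \<in> A \<Longrightarrow> w \<in> A \<Longrightarrow> (u, w) \<in> (link F \<inter> A \<times> A)\<^sup>*"
    using assms unfolding pattern_def by blast+
  obtain B where B: "reach A F B" "\<And>B'. reach A F B' \<Longrightarrow> card B' \<le> card B"
  proof -
    have "\<forall>B. reach A F B \<longrightarrow> card B < Suc (card A)"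
      using card_mono[OF fin reach_subset] by (auto simp: less_Suc_eq_le)
    from ex_has_greatest_nat[of "reach A F" "{}" card, OF reach_empty this]
    show ?thesis using that by auto
  qed
  have max: "e \<inter> A \<subseteq> B" if "e \<in> F" "\<not> e \<subseteq> A - B" for e
  proof (rule ccontr)
    assume "\<not> e \<inter> A \<subseteq> B"
    then have "B \<subset> B \<union> (e \<inter> A)" by auto
    moreover have "finite (B \<union> (e \<inter> A))" using reach_subset[OF B(1)] fin finite_subset by auto
    ultimately have "card B < card (B \<union> (e \<inter> A))" by (rule psubset_card_mono[rotated])
    then show False using B(2)[OF reach_step[OF B(1) that]] by simp
  qed
  have "A \<subseteq> B"
  proof (rule ccontr)
    assume "\<not> A \<subseteq> B"
    then obtain a where a: "a \<in> A" "a \<notin> B" by auto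
    show False
    proof (cases "B = {}")
      case True
      then show ?thesis using F max by auto
    next
      case False
      then obtain b where "b \<in> B" "b \<in> A" using reach_subset[OF B(1)] by auto
      then obtain x y where "(x, y) \<in> link F \<inter> A \<times> A" "x \<in> B" "y \<notin> B"
        using rtrancl_exits[OF conn[of b a], of B] a by blast
      then show False using max by (auto simp: link_def)
    qed
  qed
  then show ?thesis using B reach_subset by (metis subset_antisym)
qed

text \<open>Above this degree the greedy path reaches \<open>k\<close> edges, so the core is empty.
  The bound is crude but covers disconnected hypergraphs; for \<open>s = r - 1\<close> with
  \<open>r \<ge> 3\<close> its slope has order \<open>k ^ (r - 2)\<close>, which is what
  \<open>reach_single_step\<close> exploits.\<close>

lemma no_lpath_card_le:
  fixes E :: "'a set set"
  assumes fin: "finite E" "finite V" and unif: "\<And>e. e \<in> E \<Longrightarrow> card e = s" "s \<ge> 1"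
    and sub: "\<Union>E \<subseteq> V" and no: "\<not> lpath E k" and k: "k \<ge> 1"
  shows "card E \<le> ((k - 1) + ((k - 1) choose (s - 1))) * card V"
proof -
  let ?D = "(k - 1) + ((k - 1) choose (s - 1))"
  obtain C where C: "C \<subseteq> V" "\<And>v. v \<in> C \<Longrightarrow> ?D < card {e\<in>E. e \<subseteq> C \<and> v \<in> e}"
    "card E \<le> ?D * card (V - C) + card {e\<in>E. e \<subseteq> C}"
    using exists_core[OF fin(2,1) sub, of ?D] by blast
  have "C = {}"
  proof (rule ccontr)
    assume "C \<noteq> {}"
    then obtain v where v: "v \<in> C" by auto
    have "{e\<in>{e\<in>E. e \<subseteq> C}. u \<in> e} = {e\<in>E. e \<subseteq> C \<and> u \<in> e}" for u by auto
    then have "\<exists>xs. ipath {e\<in>E. e \<subseteq> C} (Inl v # xs) \<and> length xs = 2 * k"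
      using fin unif v C(2) k by (intro long_ipath_from[where s = s and C = C and m = "k - 1"]) auto
    then have "lpath {e\<in>E. e \<subseteq> C} k" by (auto simp: lpath_def)
    then show False using no lpath_mono[of "{e\<in>E. e \<subseteq> C}" k E] by auto
  qed
  moreover have "{e\<in>E. e \<subseteq> {}} = {}" using unif by force
  ultimately have "card E \<le> ?D * card (V - {}) + card ({} :: 'a set set)" using C(3) by metis
  then show ?thesis by simp
qed

text \<open>If no single vertex can ever be added to a reachable set, then every edge has two vertices in
  the block it is completed by. Deleting one of them is at most \<open>(r - 1)\<close>-to-one and yields an
  \<open>(r - 1)\<close>-uniform hypergraph, which is too sparse.\<close>

lemma reach_drop_vertex:
  assumes pat: "pattern r A F" and r: "r \<ge> 2"
    and no: "\<nexists>B z. reach A F B \<and> z \<in> A - B \<and> reach A F (insert z B)"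
    and B: "reach A F B"
  shows "\<exists>w. (\<forall>f\<in>{f\<in>F. f \<inter> A \<subseteq> B}. w f \<in> f \<inter> A \<and> (f - {w f}) \<inter> A \<noteq> {}) \<and>
     card {f\<in>F. f \<inter> A \<subseteq> B} \<le> (r - 1) * card ((\<lambda>f. f - {w f}) ` {f\<in>F. f \<inter> A \<subseteq> B})"
  using B
proof (induction rule: reach.induct)
  case reach_empty
  have "{f\<in>F. f \<inter> A \<subseteq> {}} = {}" using pat unfolding pattern_def by auto
  then show ?case by (simp only:) simp
next
  case (reach_step B e)
  have fin: "finite A" "finite F" and F: "\<And>f. f \<in> F \<Longrightarrow> f \<inter> A \<noteq> {} \<and> card f = r"
    using pat unfolding pattern_def by blast+
  let ?B = "B \<union> (e \<inter> A)"
  \<comment> \<open>\<open>W\<close> is the block added in this step, and \<open>N\<close> consists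
    of the edges it completes. Since \<open>e\<close> has a vertex outside \<open>A - B\<close>, the
    block has at most \<open>r - 1\<close> vertices.\<close>
  define W where "W = e \<inter> A - B"
  define FB where "FB = {f\<in>F. f \<inter> A \<subseteq> B}"
  define N where "N = {f\<in>F. f \<inter> A \<subseteq> ?B} - FB"
  from reach_step.IH obtain w where w: "\<And>f. f \<in> FB \<Longrightarrow> w f \<in> f \<inter> A \<and> (f - {w f}) \<inter> A \<noteq> {}"
    "card FB \<le> (r - 1) * card ((\<lambda>f. f - {w f}) ` FB)" unfolding FB_def by blast
  have "card W < card e"
  proof (rule psubset_card_mono)
    show "finite e" using F[OF \<open>e \<in> F\<close>] r by (metis card.infinite not_numeral_le_zero)
    show "W \<subset> e" using \<open>\<not> e \<subseteq> A - B\<close> unfolding W_def by blast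
  qed
  then have cW: "card W \<le> r - 1" using F[OF \<open>e \<in> F\<close>] by simp
  \<comment> \<open>An edge meeting the block in a single vertex \<open>z\<close> has another
    vertex, as \<open>r \<ge> 2\<close>, and this one is outside \<open>A - B\<close>; the edge
    would then allow adding \<open>z\<close> alone.\<close>
  have two: "\<exists>x y. x \<in> f \<inter> W \<and> y \<in> f \<inter> W \<and> x \<noteq> y" if f: "f \<in> N" for f
  proof (rule ccontr)
    assume c: "\<not> ?thesis"
    obtain z where z: "z \<in> f \<inter> W" using f unfolding N_def FB_def W_def by blast
    have fW: "f \<inter> W = {z}" using c z by blast
    have fF: "f \<in> F" "f \<inter> A \<subseteq> ?B" using f unfolding N_def by auto
    have "\<not> f \<subseteq> A - B"
    proof
      assume "f \<subseteq> A - B"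
      then have "f \<subseteq> f \<inter> W" using fF unfolding W_def by auto
      then have "card f \<le> 1" using fW card_mono[of "{z}" f] by auto
      then show False using F[OF fF(1)] r by simp
    qed
    then have "reach A F (B \<union> (f \<inter> A))" using reach.reach_step[OF reach_step.hyps(1) fF(1)] by blast
    moreover have "B \<union> (f \<inter> A) = insert z B" using fF fW z unfolding W_def by blast
    moreover have "z \<in> A - B" using z unfolding W_def by auto
    ultimately show False using no reach_step.hyps(1) by auto
  qed
  define w' where "w' f = (if f \<in> FB then w f else (SOME x. x \<in> f \<inter> W))" for f
  have w'N: "w' f \<in> f \<inter> W" if "f \<in> N" for f
  proof -
    have "w' f = (SOME x. x \<in> f \<inter> W)" using that unfolding w'_def N_def by simp
    moreover have "\<exists>x. x \<in> f \<inter> W" using two[OF that] by blast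
    ultimately show ?thesis by (metis someI_ex)
  qed
  have W: "W \<subseteq> A" "W \<inter> B = {}" unfolding W_def by auto
  let ?d = "\<lambda>f. f - {w' f}"
  have N2: "?d f \<inter> W \<noteq> {}" if "f \<in> N" for f using two[OF that] by blast
  have split: "{f\<in>F. f \<inter> A \<subseteq> ?B} = FB \<union> N" "FB \<inter> N = {}" unfolding N_def FB_def by auto
  have finFN: "finite FB" "finite N" using fin unfolding FB_def N_def by auto
  have dFB: "?d ` FB = (\<lambda>f. f - {w f}) ` FB" by (rule image_cong) (auto simp: w'_def)
  \<comment> \<open>Shrunken new edges still meet the block while shrunken old ones do not, so edges
    of different steps are never identified and the counts add up.\<close>
  have "?d ` FB \<inter> ?d ` N = {}"
  proof -
    have "?d f \<noteq> ?d g" if "f \<in> FB" "g \<in> N" for f g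
    proof -
      have "?d f \<inter> W = {}" using that(1) W unfolding FB_def by auto
      then show ?thesis using N2[OF that(2)] by metis
    qed
    then show ?thesis by blast
  qed
  then have "card (?d ` (FB \<union> N)) = card (?d ` FB) + card (?d ` N)"
    using finFN by (simp add: image_Un card_Un_disjoint)
  \<comment> \<open>A new edge is determined by its shrunken form and the dropped vertex, one of at
    most \<open>r - 1\<close> in the block.\<close>
  moreover have "card N \<le> (r - 1) * card (?d ` N)"
  proof -
    have "N \<subseteq> (\<lambda>(g, x). insert x g) ` (?d ` N \<times> W)"
    proof
      fix f assume f: "f \<in> N"
      then have "f = insert (w' f) (?d f)" using w'N by auto
      then show "f \<in> (\<lambda>(g, x). insert x g) ` (?d ` N \<times> W)" using w'N[OF f] f
        by (intro image_eqI[of _ _ "(?d f, w' f)"]) auto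
    qed
    moreover have "finite (?d ` N \<times> W)" using finFN fin unfolding W_def by auto
    ultimately have "card N \<le> card (?d ` N \<times> W)" by (meson card_image_le card_mono finite_imageI le_trans)
    also have "\<dots> \<le> (r - 1) * card (?d ` N)" using cW by (simp add: card_cartesian_product)
    finally show ?thesis .
  qed
  moreover have "card (FB \<union> N) = card FB + card N" using finFN split by (simp add: card_Un_disjoint)
  ultimately have "card (FB \<union> N) \<le> (r - 1) * card (?d ` (FB \<union> N))"
    using w(2) dFB by (simp add: distrib_left)
  moreover have "\<forall>f\<in>FB \<union> N. w' f \<in> f \<inter> A \<and> (f - {w' f}) \<inter> A \<noteq> {}"
  proof
    fix f assume "f \<in> FB \<union> N"
    then consider "f \<in> FB" | "f \<in> N" by blast
    then show "w' f \<in> f \<inter> A \<and> (f - {w' f}) \<inter> A \<noteq> {}"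
    proof cases
      case 1
      then show ?thesis using w(1) by (simp add: w'_def)
    next
      case 2
      then show ?thesis using w'N N2 W by blast
    qed
  qed
  ultimately show ?case unfolding split(1) by blast
qed

text \<open>Otherwise the shrunken edges, at least \<open>card F\<close> divided by
  \<open>r - 1\<close> in number, would again have no long path, and \<open>no_lpath_card_le\<close>
  would bound them. For \<open>r \<ge> 3\<close> the resulting threshold is of lower order in
  \<open>k\<close> than the densities to which the lemma is applied.\<close>

lemma reach_single_step:
  assumes pat: "pattern r A F" and r: "r \<ge> 2" and no: "\<not> lpath (pump A F) k" and k: "k \<ge> 1"
    and dense: "2 * (r - 1) * ((k - 1) + ((k - 1) choose (r - 2))) * card A < card F"
  shows "\<exists>B z. reach A F B \<and> z \<in> A - B \<and> reach A F (insert z B)"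
proof (rule ccontr)
  assume nost: "\<not> ?thesis"
  have fin: "finite A" "finite F" "A \<noteq> {}" and F: "\<And>f. f \<in> F \<Longrightarrow> f \<inter> A \<noteq> {} \<and> card f = r"
    using pat unfolding pattern_def by blast+
  have "{f\<in>F. f \<inter> A \<subseteq> A} = F" by auto
  then obtain w where w: "\<And>f. f \<in> F \<Longrightarrow> w f \<in> f \<inter> A \<and> (f - {w f}) \<inter> A \<noteq> {}"
    "card F \<le> (r - 1) * card ((\<lambda>f. f - {w f}) ` F)"
    using reach_drop_vertex[OF pat r nost reach_all[OF pat]] by auto
  let ?d = "\<lambda>f. f - {w f}"
  define G where "G = ?d ` F"
  define S where "S = \<Union>F - A"
  \<comment> \<open>Density is counted per vertex of \<open>A\<close>, but \<open>S\<close> may be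
    much larger than \<open>A\<close>. Once more than \<open>card S\<close> copies share
    \<open>S\<close>, its vertices are outnumbered by those of the copies of \<open>A\<close>; this
    costs the factor 2 in \<open>dense\<close>.\<close>
  define J where "J = card S + 1"
  define D where "D = (k - 1) + ((k - 1) choose (r - 2))"
  have ff: "finite f" if "f \<in> F" for f using F[OF that] r by (metis card.infinite not_numeral_le_zero)
  then have finS: "finite S" using fin unfolding S_def by auto
  have GA: "g \<inter> A \<noteq> {}" if "g \<in> G" for g using that w unfolding G_def by auto
  have cG: "card g = r - 1" if "g \<in> G" for g
    using that w(1) F ff unfolding G_def by (auto simp: card_Diff_singleton)
  let ?c = "\<lambda>(j, g). copy A j ` g"
  define P where "P = ?c ` ({..<J} \<times> G)"
  have injG: "inj_on ?c ({..<J} \<times> G)"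
  proof (rule inj_onI, clarify)
    fix i g j h assume "g \<in> G" "copy A i ` g = copy A j ` h"
    then show "i = j \<and> g = h" using GA by (intro copy_image_eq) auto
  qed
  have cP: "card P = J * card G" unfolding P_def using injG by (simp add: card_image card_cartesian_product)
  \<comment> \<open>\<open>lf\<close> restores the dropped vertex; done in each copy, this is the
    enlargement \<open>L\<close> for \<open>lpath_lift\<close>.\<close>
  define lf where "lf g = inv_into F ?d g" for g
  have lf: "lf g \<in> F" "?d (lf g) = g" if "g \<in> G" for g
    using that unfolding lf_def G_def by (auto intro: inv_into_into f_inv_into_f simp: f_inv_into_f[of g ?d F])
  define L where "L h = ?c (fst (inv_into ({..<J} \<times> G) ?c h), lf (snd (inv_into ({..<J} \<times> G) ?c h)))" for h
  have L: "L (copy A j ` g) = copy A j ` lf g" if "j < J" "g \<in> G" for j g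
  proof -
    have "inv_into ({..<J} \<times> G) ?c (?c (j, g)) = (j, g)" using that injG by (intro inv_into_f_f) auto
    then show ?thesis unfolding L_def by simp
  qed
  have "\<not> lpath P k"
  proof
    assume "lpath P k"
    then have "lpath (pump A F) k"
    proof (rule lpath_lift)
      show "inj_on L P"
      proof (rule inj_onI)
        fix h h' assume "h \<in> P" "h' \<in> P" "L h = L h'"
        then obtain j g j' g' where *: "h = copy A j ` g" "h' = copy A j' ` g'" "g \<in> G" "g' \<in> G"
          "copy A j ` lf g = copy A j' ` lf g'" unfolding P_def using L by auto
        then have "j = j' \<and> lf g = lf g'" using F lf by (intro copy_image_eq) auto
        then show "h = h'" using * lf by metis
      qed
      fix h assume "h \<in> P"
      then obtain j g where *: "h = copy A j ` g" "j < J" "g \<in> G" unfolding P_def by auto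
      then have "g \<subseteq> lf g" "lf g \<in> F" using lf by auto
      then show "h \<subseteq> L h \<and> L h \<in> pump A F" using * L unfolding pump_def by auto
    qed
    with no show False ..
  qed
  moreover have "finite P" using fin unfolding P_def G_def by auto
  moreover have "finite ({..<J} \<times> A \<union> {0} \<times> S)" using fin finS by auto
  moreover have "\<Union>P \<subseteq> {..<J} \<times> A \<union> {0} \<times> S" 
  proof
    fix p assume "p \<in> \<Union>P"
    then obtain j f x where "j < J" "f \<in> F" "x \<in> f" "p = copy A j x" unfolding P_def G_def by auto
    then show "p \<in> {..<J} \<times> A \<union> {0} \<times> S" unfolding S_def copy_def by auto
  qed
  moreover have "card h = r - 1" if "h \<in> P" for h
    using that cG unfolding P_def by (auto simp: card_image inj_on_subset[OF inj_copy])
  ultimately have "card P \<le> ((k - 1) + ((k - 1) choose (r - 1 - 1))) * card ({..<J} \<times> A \<union> {0} \<times> S)"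
    using r k by (intro no_lpath_card_le) auto
  also have "\<dots> \<le> D * (J * card A + card S)"
  proof -
    have "card ({..<J} \<times> A \<union> {0} \<times> S) \<le> card ({..<J} \<times> A) + card ({0::nat} \<times> S)" by (rule card_Un_le)
    moreover have "r - 1 - 1 = r - 2" by simp
    ultimately show ?thesis unfolding D_def by (auto simp: card_cartesian_product intro: mult_left_mono)
  qed
  also have "\<dots> \<le> D * (J * (2 * card A))"
  proof -
    have "card A \<ge> 1" using fin by (simp add: Suc_leI card_gt_0_iff)
    then have "J * 1 \<le> J * card A" by (rule mult_le_mono2)
    then have "card S \<le> J * card A" unfolding J_def by simp
    then show ?thesis by (intro mult_left_mono) auto
  qed
  finally have "J * card G \<le> J * (2 * D * card A)" unfolding cP by (simp add: mult_ac)
  then have "card G \<le> 2 * D * card A" by (subst (asm) mult_le_cancel1) (simp add: J_def)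
  then have "card F \<le> (r - 1) * (2 * D * card A)" using w(2) unfolding G_def by (meson le_trans mult_le_mono2)
  also have "\<dots> = 2 * (r - 1) * D * card A" by (simp only: mult_ac)
  also have "\<dots> < card F" using dense unfolding D_def .
  finally show False by simp
qed

section \<open>Copies on any large number of vertices\<close>

text \<open>\<open>J\<close> full copies are accompanied by exactly \<open>a = card A\<close>
  partial ones, \<open>i < a\<close> of them on \<open>insert z B\<close> and the others on
  \<open>B\<close>. Varying \<open>i\<close> reaches every residue modulo \<open>a\<close>, and
  boundedly many vertices lie outside the full copies.\<close>

lemma pump_hypergraph:
  fixes A :: "'b set"
  assumes pat: "pattern r A F" and r: "r \<ge> 1"
    and B: "reach A F B" "z \<in> A - B" "reach A F (insert z B)"
  shows "\<exists>n0 c. \<forall>n\<ge>n0. \<exists>V E. finite V \<and> card V = n \<and> (\<forall>e\<in>E. e \<subseteq> V \<and> card e = r) \<and>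
    (\<forall>u\<in>V. \<forall>w\<in>V. (u, w) \<in> (link E)\<^sup>*) \<and> E \<subseteq> pump A F \<and> card F * n \<le> card A * card E + c"
proof -
  have fin: "finite A" "finite F" "A \<noteq> {}" and F: "\<And>f. f \<in> F \<Longrightarrow> f \<inter> A \<noteq> {} \<and> card f = r"
    and conn: "\<And>u w. u \<in> A \<Longrightarrow> w \<in> A \<Longrightarrow> (u, w) \<in> (link F \<inter> A \<times> A)\<^sup>*"
    using pat unfolding pattern_def by blast+
  have ff: "finite f" if "f \<in> F" for f using F[OF that] r by (metis card.infinite not_one_le_zero)
  define S where "S = \<Union>F - A"
  have finS: "finite S" using fin ff unfolding S_def by auto
  have BA: "B \<subseteq> A" using B(1) reach_subset by blast
  have finB: "finite B" using BA fin finite_subset by blast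
  define a b where "a = card A" and "b = card B"
  have a: "a > 0" using fin unfolding a_def by (simp add: card_gt_0_iff)
  have ab: "b \<le> a" unfolding a_def b_def using BA fin by (simp add: card_mono)
  \<comment> \<open>For \<open>i = 0\<close>, this counts the vertices outside the full copies: the
    attachment vertices and \<open>a\<close> copies of \<open>B\<close>.\<close>
  define base where "base = card S + a * b"
  have "\<exists>V E. finite V \<and> card V = n \<and> (\<forall>e\<in>E. e \<subseteq> V \<and> card e = r) \<and>
    (\<forall>u\<in>V. \<forall>w\<in>V. (u, w) \<in> (link E)\<^sup>*) \<and> E \<subseteq> pump A F \<and>
    card F * n \<le> a * card E + card F * (base + a)" if n: "n \<ge> base + a" for n
  proof -
    define J i where "J = (n - base) div a" and "i = (n - base) mod a"
    have J: "J \<ge> 1" unfolding J_def using n a by (simp add: Suc_leI div_greater_zero_iff)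
    have i: "i < a" unfolding i_def using a by simp
    have nJ: "n = base + J * a + i" unfolding J_def i_def using n by simp
    define C where "C j = (if j < J then A else if j < J + i then insert z B else B)" for j
    have reachC: "reach A F (C j)" for j
      unfolding C_def using B reach_all[OF pat] by auto
    have CA: "C j \<subseteq> A" for j using reachC reach_subset by blast
    have finC: "finite (C j)" for j using CA fin finite_subset by blast
    define V where "V = (SIGMA j:{..<J + a}. C j) \<union> {0} \<times> S"
    define I where "I = {(j, e). j < J + a \<and> e \<in> F \<and> e \<inter> A \<subseteq> C j}"
    define E where "E = (\<lambda>(j, e). copy A j ` e) ` I"
    have "finite I"
      by (rule finite_subset[of _ "{..<J + a} \<times> F"]) (use fin in \<open>auto simp: I_def\<close>)
    then have finE: "finite E" unfolding E_def by simp
    have finV: "finite V" unfolding V_def using finC finS by auto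
    have "card V = card (SIGMA j:{..<J + a}. C j) + card ({0::nat} \<times> S)"
      unfolding V_def using finC finS CA by (intro card_Un_disjoint) (auto simp: S_def)
    also have "card (SIGMA j:{..<J + a}. C j) = (\<Sum>j<J + a. card (C j))"
      using finC by (simp add: card_SigmaI)
    also have "(\<Sum>j<J + a. card (C j)) = (\<Sum>j<J. card (C j)) + (\<Sum>j=J..<J + i. card (C j)) + (\<Sum>j=J + i..<J + a. card (C j))"
      using i by (simp add: lessThan_atLeast0 sum.atLeastLessThan_concat)
    also have "(\<Sum>j<J. card (C j)) = J * a" unfolding C_def a_def by simp
    also have "(\<Sum>j=J..<J + i. card (C j)) = (\<Sum>j=J..<J + i. b + 1)"
      using B(2) finB by (intro sum.cong) (auto simp: C_def b_def)
    also have "\<dots> = i * (b + 1)" by simp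
    also have "(\<Sum>j=J + i..<J + a. card (C j)) = (\<Sum>j=J + i..<J + a. b)"
      by (intro sum.cong) (auto simp: C_def b_def)
    also have "\<dots> = (a - i) * b" by simp
    finally have "card V = J * a + i * (b + 1) + (a - i) * b + card S" by (simp add: card_cartesian_product)
    moreover have "i * (b + 1) + (a - i) * b = i + a * b"
    proof -
      have "i * b + (a - i) * b = a * b" using i by (simp flip: distrib_right)
      then show ?thesis by simp
    qed
    ultimately have cV: "card V = n" unfolding nJ base_def by simp
    have EV: "e \<subseteq> V \<and> card e = r" if "e \<in> E" for e
    proof -
      from that obtain j f where f: "e = copy A j ` f" "j < J + a" "f \<in> F" "f \<inter> A \<subseteq> C j"
        unfolding E_def I_def by auto
      have "copy A j x \<in> V" if "x \<in> f" for x
        using f that CA unfolding V_def S_def copy_def by auto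
      moreover have "card e = r" using f F by (simp add: card_image inj_on_subset[OF inj_copy])
      ultimately show ?thesis using f by auto
    qed
    have Emem: "copy A j ` f \<in> E" if "j < J + a" "f \<in> F" "f \<inter> A \<subseteq> C j" for j f
      unfolding E_def I_def using that by (intro image_eqI[of _ _ "(j, f)"]) auto
    have lnk: "(copy A j x, copy A j y) \<in> link E" if "j < J + a" "f \<in> F" "f \<inter> A \<subseteq> C j" "x \<in> f" "y \<in> f" for j f x y
      using Emem[OF that(1-3)] that(4,5) unfolding link_def by blast
    \<comment> \<open>Retracing the construction of \<open>reach\<close>, each vertex walks to an
      attachment vertex along edges of its own partial copy.\<close>
    have to_S: "\<exists>s\<in>S. (copy A j v, copy A j s) \<in> (link E)\<^sup>*"
      if "reach A F D" "D \<subseteq> C j" "v \<in> D" "j < J + a" for D j v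
      using that
    proof (induction arbitrary: v rule: reach.induct)
      case (reach_step D e)
      show ?case
      proof (cases "v \<in> D")
        case True
        then show ?thesis using reach_step by auto
      next
        case False
        then have v: "v \<in> e" using reach_step by auto
        obtain x where x: "x \<in> e" "x \<notin> A - D" using reach_step by auto
        have l: "(copy A j v, copy A j x) \<in> link E"
          using reach_step v x by (intro lnk[of j e]) auto
        show ?thesis
        proof (cases "x \<in> A")
          case True
          then obtain s where "s \<in> S" "(copy A j x, copy A j s) \<in> (link E)\<^sup>*"
            using reach_step.IH[of x] reach_step.prems x by auto
          then show ?thesis using l by (meson converse_rtrancl_into_rtrancl)
        next
          case False
          then have "x \<in> S" using x reach_step by (auto simp: S_def)
          then show ?thesis using l by blast
        qed
      qed
    qed auto
    have copyS: "copy A j s = (0, s)" if "s \<in> S" for j s using that by (simp add: copy_def S_def)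
    \<comment> \<open>Copy 0 is full because \<open>J \<ge> 1\<close>, hence connected; it serves as
      the hub.\<close>
    have A0: "(copy A 0 x, copy A 0 y) \<in> (link E)\<^sup>*" if "x \<in> A" "y \<in> A" for x y
    proof -
      have "(x, y) \<in> (link F \<inter> A \<times> A)\<^sup>*" using conn that by blast
      then show ?thesis
      proof (induction rule: rtrancl_induct)
        case (step y z)
        then obtain f where "f \<in> F" "y \<in> f" "z \<in> f" by (auto simp: link_def)
        then have "(copy A 0 y, copy A 0 z) \<in> link E" using J by (intro lnk[of 0 f]) (auto simp: C_def)
        then show ?case using step.IH by (rule rtrancl_into_rtrancl[rotated])
      qed auto
    qed
    have S_A: "\<exists>x\<in>A. ((0, s), copy A 0 x) \<in> link E" if s: "s \<in> S" for s
    proof -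
      obtain f where f: "f \<in> F" "s \<in> f" using s by (auto simp: S_def)
      then obtain x where "x \<in> f" "x \<in> A" using F by blast
      then show ?thesis using lnk[of 0 f s x] f J copyS[OF s] by (auto simp: C_def)
    qed
    obtain x0 where x0: "x0 \<in> A" using fin by auto
    have S0: "((0, s), copy A 0 x0) \<in> (link E)\<^sup>*" if "s \<in> S" for s
      using S_A[OF that] A0[OF _ x0] by (meson converse_rtrancl_into_rtrancl)
    have V0: "(p, copy A 0 x0) \<in> (link E)\<^sup>*" if p: "p \<in> V" for p
    proof (cases "p \<in> {0} \<times> S")
      case True
      then show ?thesis using S0 by auto
    next
      case False
      then obtain j v where v: "p = (j, v)" "j < J + a" "v \<in> C j" using p unfolding V_def by auto
      then have "p = copy A j v" using CA by (auto simp: copy_def)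
      moreover obtain s where "s \<in> S" "(copy A j v, copy A j s) \<in> (link E)\<^sup>*"
        using to_S[OF reachC[of j] order_refl v(3,2)] by blast
      ultimately show ?thesis using S0[of s] copyS[of s j] by (metis rtrancl_trans)
    qed
    have conE: "(u, w) \<in> (link E)\<^sup>*" if "u \<in> V" "w \<in> V" for u w
      using V0[OF that(1)] link_rtrancl_sym[OF V0[OF that(2)]] by (rule rtrancl_trans)
    have "J * card F \<le> card E"
    proof -
      let ?c = "\<lambda>(j, e). copy A j ` e"
      have "inj_on ?c ({..<J} \<times> F)"
      proof (rule inj_onI, clarify)
        fix i g j h assume "g \<in> F" "copy A i ` g = copy A j ` h"
        then show "i = j \<and> g = h" using F by (intro copy_image_eq) auto
      qed
      then have "card (?c ` ({..<J} \<times> F)) = J * card F" by (simp add: card_image card_cartesian_product)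
      moreover have "?c ` ({..<J} \<times> F) \<subseteq> E" using Emem by (auto simp: C_def)
      ultimately show ?thesis using card_mono[OF finE] by metis
    qed
    then have "card F * n \<le> a * card E + card F * (base + a)"
    proof -
      assume JE: "J * card F \<le> card E"
      have "card F * n = a * (J * card F) + card F * (base + i)" unfolding nJ by (simp add: algebra_simps)
      also have "\<dots> \<le> a * card E + card F * (base + a)"
        using JE i by (intro add_mono mult_left_mono) auto
      finally show ?thesis .
    qed
    moreover have "E \<subseteq> pump A F" unfolding E_def I_def pump_def by auto
    ultimately show ?thesis using finV cV EV conE
      by (intro exI[of _ V] exI[of _ E] conjI ballI) auto
  qed
  then show ?thesis unfolding a_def by (intro exI[of _ "base + card A"] exI[of _ "card F * (base + card A)"]) auto
qed

section \<open>Dense hypergraphs contain many copies of a dense piece\<close>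

definition touching :: "'a set set \<Rightarrow> 'a set \<Rightarrow> 'a set set" where
  "touching E Y = {e\<in>E. e \<inter> Y \<noteq> {}}"

text \<open>A connected component left after removing the vertices of \<open>S\<close> from all
  edges, with at least one edge to \<open>S\<close>. Linked vertices of \<open>Y\<close> share an
  edge that may contain vertices of \<open>S\<close> as well.\<close>

definition piece :: "'a set set \<Rightarrow> 'a set \<Rightarrow> 'a set \<Rightarrow> bool" where
  "piece E S Y \<longleftrightarrow> finite Y \<and> Y \<noteq> {} \<and> Y \<inter> S = {} \<and> (\<forall>u\<in>Y. \<forall>w\<in>Y. (u, w) \<in> (link E \<inter> Y \<times> Y)\<^sup>*) \<and>
     (\<forall>e\<in>touching E Y. e \<subseteq> Y \<union> S) \<and> (\<exists>e\<in>touching E Y. e \<inter> S \<noteq> {})"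

lemma pattern_image_piece:
  assumes p: "piece E S Y" and fin: "finite E" and unif: "\<And>e. e \<in> E \<Longrightarrow> card e = r"
    and inj: "inj_on g (Y \<union> S)"
  shows "pattern r (g ` Y) ((`) g ` touching E Y)"
proof -
  let ?F = "(`) g ` touching E Y"
  have Y: "finite Y" "Y \<noteq> {}" "Y \<inter> S = {}" "\<And>e. e \<in> touching E Y \<Longrightarrow> e \<subseteq> Y \<union> S"
    and conn: "\<And>u w. u \<in> Y \<Longrightarrow> w \<in> Y \<Longrightarrow> (u, w) \<in> (link E \<inter> Y \<times> Y)\<^sup>*"
    and out: "\<exists>e\<in>touching E Y. e \<inter> S \<noteq> {}"
    using p unfolding piece_def by blast+
  have "card e = r \<and> e \<inter> g ` Y \<noteq> {}" if "e \<in> ?F" for e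
  proof -
    from that obtain e' where e': "e = g ` e'" "e' \<in> touching E Y" by blast
    then have "inj_on g e'" using Y(4) inj inj_on_subset by blast
    then show ?thesis using e' unif unfolding touching_def by (auto simp: card_image)
  qed
  moreover have "(g u, g w) \<in> (link ?F \<inter> g ` Y \<times> g ` Y)\<^sup>*" if "u \<in> Y" "w \<in> Y" for u w
    using conn[OF that]
  proof (induction rule: rtrancl_induct)
    case (step y z)
    then obtain e where e: "e \<in> E" "y \<in> e" "z \<in> e" "y \<in> Y" "z \<in> Y" by (auto simp: link_def)
    then have "e \<in> touching E Y" by (auto simp: touching_def)
    then have "(g y, g z) \<in> link ?F" using e unfolding link_def by blast
    then have "(g y, g z) \<in> link ?F \<inter> g ` Y \<times> g ` Y" using e by auto
    with step.IH show ?case by (rule rtrancl_into_rtrancl)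
  qed auto
  moreover have "\<exists>e\<in>?F. \<not> e \<subseteq> g ` Y"
  proof -
    obtain e x where e: "e \<in> touching E Y" "x \<in> e" "x \<in> S" using out by blast
    have "g x \<notin> g ` Y"
    proof
      assume "g x \<in> g ` Y"
      then obtain y where "y \<in> Y" "g x = g y" by blast
      then have "x = y" using inj e by (auto dest: inj_onD)
      then show False using \<open>y \<in> Y\<close> e Y(3) by auto
    qed
    then show ?thesis using e by blast
  qed
  moreover have "finite (touching E Y)" using fin by (simp add: touching_def)
  ultimately show ?thesis unfolding pattern_def using Y by auto
qed

text \<open>Isomorphic pieces must also be attached alike. So \<open>S\<close> gets one common
  labelling, every piece labels its own vertices from a disjoint range, and pieces are classified by
  their labelled picture. Inverting the labellings of \<open>k\<close> equal pictures gives
  embeddings that agree on the kernel.\<close>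

lemma many_pieces_realized:
  fixes E :: "'a set set" and lam :: real
  assumes fin: "finite E" "finite S" "finite P" and unif: "\<And>e. e \<in> E \<Longrightarrow> card e = r"
    and cS: "card S \<le> s"
    and P: "\<And>Y. Y \<in> P \<Longrightarrow> piece E S Y \<and> card Y \<le> t \<and> lam * card Y < card (touching E Y)"
    and disj: "\<And>Y Y'. Y \<in> P \<Longrightarrow> Y' \<in> P \<Longrightarrow> Y \<noteq> Y' \<Longrightarrow> Y \<inter> Y' = {}"
    and big: "k * (2 ^ (s + t) * 2 ^ 2 ^ (s + t)) \<le> card P" and k: "k \<ge> 1"
  shows "\<exists>(A :: nat set) F. pattern r A F \<and> lam * card A < card F \<and> realized k E A F"
proof -
  obtain gS :: "'a \<Rightarrow> nat" where gS: "inj_on gS S" "gS ` S \<subseteq> {..<s}"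
    using card_le_inj[of S "{..<s}"] fin cS by auto
  have "\<exists>h. inj_on h Y \<and> h ` Y \<subseteq> {s..<s + t}" if "Y \<in> P" for Y
    using card_le_inj[of Y "{s..<s + t}"] P[OF that] by (auto simp: piece_def)
  then obtain h :: "'a set \<Rightarrow> 'a \<Rightarrow> nat" where h: "\<And>Y. Y \<in> P \<Longrightarrow> inj_on (h Y) Y \<and> h Y ` Y \<subseteq> {s..<s + t}" by metis
  define g where "g Y x = (if x \<in> S then gS x else h Y x)" for Y x
  have pc: "Y \<inter> S = {}" "piece E S Y" "\<And>e. e \<in> touching E Y \<Longrightarrow> e \<subseteq> Y \<union> S" if "Y \<in> P" for Y
    using P[OF that] unfolding piece_def by auto
  have gY: "g Y x = h Y x" if "Y \<in> P" "x \<in> Y" for Y x using pc(1)[OF that(1)] that unfolding g_def by auto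
  have ran: "g Y ` (Y \<union> S) \<subseteq> {..<s + t}" if "Y \<in> P" for Y
    using h[OF that] gS gY[OF that] unfolding g_def by force
  have inj: "inj_on (g Y) (Y \<union> S)" if Y: "Y \<in> P" for Y
  proof (rule inj_onI)
    fix x y assume xy: "x \<in> Y \<union> S" "y \<in> Y \<union> S" "g Y x = g Y y"
    have lt: "gS u < s" if "u \<in> S" for u using gS that by auto
    have ge: "s \<le> h Y u" if "u \<in> Y" for u using h[OF Y] that by auto
    show "x = y"
    proof (cases "x \<in> S"; cases "y \<in> S")
      assume "x \<in> S" "y \<in> S"
      then show ?thesis using xy gS by (auto simp: g_def dest: inj_onD)
    next
      assume "x \<in> S" "y \<notin> S"
      then show ?thesis using xy lt[of x] ge[of y] by (auto simp: g_def)
    next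
      assume "x \<notin> S" "y \<in> S"
      then show ?thesis using xy lt[of y] ge[of x] by (auto simp: g_def)
    next
      assume "x \<notin> S" "y \<notin> S"
      then show ?thesis using xy h[OF Y] by (auto simp: g_def dest: inj_onD)
    qed
  qed
  define ty where "ty Y = (g Y ` Y, (`) (g Y) ` touching E Y)" for Y
  \<comment> \<open>A picture is a set of labels with a family of such sets, whence the number in
    \<open>big\<close>.\<close>
  define T where "T = Pow {..<s + t} \<times> Pow (Pow {..<s + t})"
  have finT: "finite T" and cT: "card T = 2 ^ (s + t) * 2 ^ 2 ^ (s + t)"
    unfolding T_def by (auto simp: card_cartesian_product card_Pow)
  have tyT: "ty Y \<in> T" if "Y \<in> P" for Y
    using ran[OF that] pc(3)[OF that] unfolding ty_def T_def by fastforce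
  obtain \<tau> where \<tau>: "k \<le> card {Y\<in>P. ty Y = \<tau>}"
  proof (rule ccontr)
    assume "\<not> thesis"
    then have "\<not> k \<le> card {Y\<in>P. ty Y = \<tau>}" for \<tau> using that by blast
    moreover have "n \<le> k - 1" if "\<not> k \<le> n" for n using that by linarith
    ultimately have small: "card {Y\<in>P. ty Y = \<tau>} \<le> k - 1" for \<tau> by blast
    have "P = (\<Union>\<tau>\<in>T. {Y\<in>P. ty Y = \<tau>})" using tyT by auto
    then have "card P = card (\<Union>\<tau>\<in>T. {Y\<in>P. ty Y = \<tau>})" by (rule arg_cong)
    also have "\<dots> \<le> (\<Sum>\<tau>\<in>T. card {Y\<in>P. ty Y = \<tau>})" by (rule card_UN_le[OF finT])
    also have "\<dots> \<le> (\<Sum>\<tau>\<in>T. k - 1)" using small by (rule sum_mono)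
    also have "\<dots> = (k - 1) * card T" by simp
    also have "\<dots> < k * card T" using k cT by simp
    finally show False using big cT by simp
  qed
  obtain Q where Q: "Q \<subseteq> {Y\<in>P. ty Y = \<tau>}" "card Q = k" "finite Q" using obtain_subset_with_card_n[OF \<tau>] by blast
  obtain Y where Y: "bij_betw Y {..<k} Q" using Q by (metis ex_bij_betw_nat_finite atLeast0LessThan)
  have YP: "Y i \<in> P" "ty (Y i) = \<tau>" if "i < k" for i using Y Q that by (auto dest: bij_betwE)
  obtain A F where AF: "\<tau> = (A, F)" by (cases \<tau>)
  have A: "A = g (Y i) ` Y i" and F: "F = (`) (g (Y i)) ` touching E (Y i)" if "i < k" for i
    using YP[OF that] AF unfolding ty_def by auto
  define \<theta> where "\<theta> i = inv_into (Y i \<union> S) (g (Y i))" for i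
  have inv: "\<theta> i (g (Y i) x) = x" if "i < k" "x \<in> Y i \<union> S" for i x
    unfolding \<theta>_def using inj[OF YP(1)[OF that(1)]] that(2) by (rule inv_into_f_f)
  have sub: "A \<union> \<Union>F \<subseteq> g (Y i) ` (Y i \<union> S)" if "i < k" for i
    using A[OF that] F[OF that] pc(3)[OF YP(1)[OF that]] by blast
  have "realized k E A F"
    unfolding realized_def
  proof (intro exI[of _ \<theta>] allI impI conjI ballI)
    fix i assume i: "i < k"
    show "inj_on (\<theta> i) (A \<union> \<Union>F)"
      unfolding \<theta>_def by (rule inj_on_inv_into) (rule sub[OF i])
    have img: "\<theta> i ` g (Y i) ` X = X" if "X \<subseteq> Y i \<union> S" for X
    proof -
      have "\<theta> i (g (Y i) x) = x" if "x \<in> X" for x using inv[OF i] that \<open>X \<subseteq> Y i \<union> S\<close> by blast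
      then show ?thesis by (simp add: image_image)
    qed
    show "\<theta> i ` e \<in> E" if "e \<in> F" for e
    proof -
      obtain e' where "e = g (Y i) ` e'" "e' \<in> touching E (Y i)" using \<open>e \<in> F\<close> F[OF i] by blast
      then show ?thesis using img[of e'] pc(3)[OF YP(1)[OF i]] by (auto simp: touching_def)
    qed
    fix j assume j: "j < k"
    show "\<theta> i s = \<theta> j s" if s: "s \<in> \<Union>F - A" for s
    proof -
      obtain x where x: "x \<in> Y i \<union> S" "s = g (Y i) x" using sub[OF i] s by blast
      then have "x \<in> S" using s A[OF i] by auto
      then have "s = g (Y j) x" using x by (simp add: g_def)
      then show ?thesis using inv[OF i, of x] inv[OF j, of x] x \<open>x \<in> S\<close> by auto
    qed
    show "\<theta> i ` A \<inter> \<theta> j ` A = {}" if "i \<noteq> j"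
    proof -
      have "\<theta> i ` A = Y i" using img[of "Y i"] A[OF i] by simp
      moreover have "\<theta> j ` A = Y j"
      proof -
        have "\<theta> j (g (Y j) x) = x" if "x \<in> Y j" for x using inv[OF j] that by blast
        then show ?thesis using A[OF j] by (simp add: image_image)
      qed
      moreover have "Y i \<noteq> Y j" using Y that i j by (auto simp: bij_betw_def dest: inj_onD)
      ultimately show ?thesis using disj YP i j by metis
    qed
  qed
  moreover have "pattern r A F"
    using pattern_image_piece[OF pc(2)[OF YP(1)] fin(1) unif inj[OF YP(1)], of 0] A[of 0] F[of 0] k by simp
  moreover have "lam * card A < card F"
  proof -
    have 0: "0 < k" using k by simp
    note Y0 = YP(1)[OF 0]
    have "card A = card (Y 0)" unfolding A[OF 0] by (rule card_image) (rule inj_on_subset[OF inj[OF Y0]], auto)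
    moreover have "card F = card (touching E (Y 0))"
      unfolding F[OF 0]
    proof (rule card_image, rule inj_onI)
      fix e f assume "e \<in> touching E (Y 0)" "f \<in> touching E (Y 0)" "g (Y 0) ` e = g (Y 0) ` f"
      then show "e = f" using inj_on_image_eq_iff[OF inj[OF Y0]] pc(3)[OF Y0] by metis
    qed
    ultimately show ?thesis using P[OF Y0] by simp
  qed
  ultimately show ?thesis by blast
qed

section \<open>Bounding the density by repeated deletion\<close>

text \<open>One round: deleting \<open>D\<close> splits \<open>Y\<close> into components. Small
  components of density above \<open>lam\<close> are bad; by pigeonhole there are boundedly many,
  and each pays \<open>c\<close>. A component with more than \<open>t\<close> vertices absorbs
  \<open>c\<close> in the slack \<open>\<delta>\<close> per vertex, and a small good one has density
  at most \<open>lam \<le> mu\<close>. Edges inside \<open>S \<union> D\<close> number at most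
  \<open>2 ^ s\<close>.\<close>

lemma touching_decompose:
  fixes E :: "'a set set" and lam mu \<delta> c :: real
  assumes fin: "finite E" "finite Y" "finite S" "finite D" and unif: "\<And>e. e \<in> E \<Longrightarrow> card e = r"
    and conn: "\<And>u w. u \<in> Y \<Longrightarrow> w \<in> Y \<Longrightarrow> (u, w) \<in> (link E \<inter> Y \<times> Y)\<^sup>*"
    and disj: "Y \<inter> S = {}" and closed: "\<And>e. e \<in> touching E Y \<Longrightarrow> e \<subseteq> Y \<union> S"
    and D: "Y \<inter> D \<noteq> {}" "card (S \<union> D) \<le> s"
    and nreal: "\<nexists>(A :: nat set) F. pattern r A F \<and> lam * card A < card F \<and> realized k E A F"
    and k: "k \<ge> 1"
    and comps: "\<And>Z. Z \<subseteq> Y - D \<Longrightarrow> piece E (S \<union> D) Z \<Longrightarrow> \<exists>e\<in>touching E Z. e \<inter> Y \<inter> D \<noteq> {} \<Longrightarrow>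
      card (touching E Z) \<le> mu * card Z + c"
    and num: "0 \<le> lam" "lam \<le> mu" "0 < \<delta>" "0 \<le> c" "c \<le> \<delta> * real t"
  shows "card (touching E Y) \<le> (mu + \<delta>) * card Y + (2 ^ s + real (k * (2 ^ (s + t) * 2 ^ 2 ^ (s + t))) * c)"
proof -
  define q where "q = k * (2 ^ (s + t) * 2 ^ 2 ^ (s + t))"
  define Z where "Z = Y - D"
  define R where "R = {(u, w). u \<in> Z \<and> w \<in> Z \<and> (u, w) \<in> (link E \<inter> Z \<times> Z)\<^sup>*}"
  have sym: "sym (link E \<inter> Z \<times> Z)" by (auto simp: sym_def link_def)
  have eqv: "equiv Z R"
    unfolding equiv_def refl_on_def
    using sym_rtrancl[OF sym] by (auto simp: R_def sym_def trans_def intro: rtrancl_trans)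
  define P where "P = Z // R"
  have finZ: "finite Z" unfolding Z_def using fin by simp
  have finP: "finite P" unfolding P_def using finZ by (rule finite_quotient) (auto simp: R_def)
  have UP: "\<Union>P = Z" unfolding P_def using eqv by (rule Union_quotient)
  have PZ: "X \<subseteq> Z" if "X \<in> P" for X using UP that by auto
  have dis: "X \<inter> X' = {}" if "X \<in> P" "X' \<in> P" "X \<noteq> X'" for X X'
    using quotient_disj[OF eqv] that unfolding P_def by blast
  have comp_closed: "y \<in> X" if "X \<in> P" "x \<in> X" "y \<in> Z" "(x, y) \<in> link E" for X x y
  proof -
    have "x \<in> Z" using PZ that by auto
    then have "(x, y) \<in> R" using that unfolding R_def by auto
    then show ?thesis using in_quotient_imp_closed[OF eqv] that unfolding P_def by metis
  qed
  \<comment> \<open>As \<open>Y\<close> is connected and meets \<open>D\<close>, every component has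
    an edge into \<open>Y \<inter> D\<close>; this lets the probing path go on.\<close>
  have out: "\<exists>e\<in>touching E X. e \<inter> Y \<inter> D \<noteq> {}" if X: "X \<in> P" "X \<noteq> {}" for X
  proof -
    obtain b where b: "b \<in> X" using X by auto
    obtain a where a: "a \<in> Y" "a \<in> D" using D by auto
    have "b \<in> Y" "a \<notin> X" using PZ[OF X(1)] a b unfolding Z_def by auto
    then obtain p p' where p: "(p, p') \<in> link E \<inter> Y \<times> Y" "p \<in> X" "p' \<notin> X"
      using rtrancl_exits[OF conn[of b a], of X] a b by auto
    then have "p' \<in> D" using comp_closed[OF X(1) p(2), of p'] unfolding Z_def by auto
    then show ?thesis using p unfolding link_def touching_def by blast
  qed
  have pieceP: "piece E (S \<union> D) X" if X: "X \<in> P" for X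
  proof -
    have ne: "X \<noteq> {}" using in_quotient_imp_non_empty[OF eqv] X unfolding P_def by auto
    have XZ: "X \<subseteq> Z" using PZ X .
    have "(u, w) \<in> (link E \<inter> X \<times> X)\<^sup>*" if u: "u \<in> X" and w: "w \<in> X" for u w
    proof -
      have "(u, w) \<in> R" using quotient_eq_iff[OF eqv] X u w unfolding P_def by metis
      then have "(u, w) \<in> (link E \<inter> Z \<times> Z)\<^sup>*" by (simp add: R_def)
      then have "w \<in> X \<and> (u, w) \<in> (link E \<inter> X \<times> X)\<^sup>*"
      proof (induction rule: rtrancl_induct)
        case (step y z)
        then have "y \<in> X" "(y, z) \<in> link E" "z \<in> Z" by auto
        then have "z \<in> X" using comp_closed[OF X] by blast
        then have "(y, z) \<in> link E \<inter> X \<times> X" using \<open>y \<in> X\<close> \<open>(y, z) \<in> link E\<close> by auto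
        then show ?case using step.IH \<open>z \<in> X\<close> by (auto intro: rtrancl_into_rtrancl)
      qed (use u in auto)
      then show ?thesis ..
    qed
    moreover have "e \<subseteq> X \<union> (S \<union> D)" if e: "e \<in> touching E X" for e
    proof
      fix x assume x: "x \<in> e"
      obtain y where y: "y \<in> e" "y \<in> X" "e \<in> E" using e unfolding touching_def by auto
      have "e \<in> touching E Y" using y XZ unfolding touching_def Z_def by auto
      then have "x \<in> Y \<union> S" using closed x by auto
      moreover have "x \<in> X" if "x \<in> Z" using comp_closed[OF X y(2) that] x y unfolding link_def by auto
      ultimately show "x \<in> X \<union> (S \<union> D)" unfolding Z_def by auto
    qed
    moreover have "finite X" "X \<inter> (S \<union> D) = {}" using XZ finZ finite_subset disj unfolding Z_def by auto
    moreover have "\<exists>e\<in>touching E X. e \<inter> (S \<union> D) \<noteq> {}" using out[OF X ne] by blast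
    ultimately show ?thesis unfolding piece_def using ne by blast
  qed
  define Bad where "Bad = {X\<in>P. card X \<le> t \<and> lam * card X < card (touching E X)}"
  have finBad: "finite Bad" unfolding Bad_def using finP by simp
  have cBad: "card Bad \<le> q"
  proof (rule ccontr)
    assume "\<not> card Bad \<le> q"
    then have big: "k * (2 ^ (s + t) * 2 ^ 2 ^ (s + t)) \<le> card Bad" unfolding q_def by (simp only: not_le less_imp_le)
    have "\<exists>(A :: nat set) F. pattern r A F \<and> lam * card A < card F \<and> realized k E A F"
    proof (rule many_pieces_realized[OF fin(1) _ finBad unif D(2) _ _ big k])
      show "finite (S \<union> D)" using fin by simp
    qed (use pieceP dis in \<open>auto simp: Bad_def\<close>)
    then show False using nreal by blast
  qed
  have each: "real (card (touching E X)) \<le> (mu + \<delta>) * card X + (if X \<in> Bad then c else 0)" if X: "X \<in> P" for X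
  proof -
    have ne: "X \<noteq> {}" using in_quotient_imp_non_empty[OF eqv] X unfolding P_def by auto
    have b: "card (touching E X) \<le> mu * card X + c"
      using PZ[OF X] out[OF X ne] by (intro comps[OF _ pieceP[OF X]]) (auto simp: Z_def)
    show ?thesis
    proof (cases "card X \<le> t")
      case True
      show ?thesis
      proof (cases "X \<in> Bad")
        case True
        have "mu * card X \<le> (mu + \<delta>) * card X" using num by (intro mult_right_mono) auto
        then show ?thesis using b True by simp
      next
        case False
        then have "card (touching E X) \<le> lam * card X" using X True unfolding Bad_def by auto
        also have "\<dots> \<le> (mu + \<delta>) * card X" using num by (intro mult_right_mono) auto
        finally show ?thesis using False by simp
      qed
    next
      case False
      then have "\<delta> * real t \<le> \<delta> * card X" using num by (intro mult_left_mono) auto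
      moreover have "X \<notin> Bad" using False unfolding Bad_def by auto
      ultimately show ?thesis using b num(5) unfolding distrib_right if_not_P[OF \<open>X \<notin> Bad\<close>] by linarith
    qed
  qed
  have "touching E Y \<subseteq> Pow (S \<union> D) \<union> (\<Union>X\<in>P. touching E X)"
  proof
    fix e assume e: "e \<in> touching E Y"
    show "e \<in> Pow (S \<union> D) \<union> (\<Union>X\<in>P. touching E X)"
    proof (cases "e \<inter> Z = {}")
      case True
      then show ?thesis using closed[OF e] unfolding Z_def by auto
    next
      case False
      then show ?thesis using e unfolding UP[symmetric] touching_def by blast
    qed
  qed
  moreover have "finite (Pow (S \<union> D) \<union> (\<Union>X\<in>P. touching E X))"
    using fin finP by (auto simp: touching_def)
  ultimately have "card (touching E Y) \<le> card (Pow (S \<union> D)) + card (\<Union>X\<in>P. touching E X)"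
    by (meson card_Un_le card_mono le_trans)
  also have "\<dots> \<le> 2 ^ s + (\<Sum>X\<in>P. card (touching E X))"
    using card_UN_le[OF finP, of "touching E"] D(2) fin by (intro add_mono) (auto simp: card_Pow)
  finally have N: "card (touching E Y) \<le> 2 ^ s + (\<Sum>X\<in>P. card (touching E X))" .
  have "real (card (touching E Y)) \<le> real (2 ^ s + (\<Sum>X\<in>P. card (touching E X)))"
    using N by (simp only: of_nat_le_iff)
  also have "\<dots> = 2 ^ s + (\<Sum>X\<in>P. real (card (touching E X)))" by simp
  also have "(\<Sum>X\<in>P. real (card (touching E X))) \<le> (\<Sum>X\<in>P. (mu + \<delta>) * card X + (if X \<in> Bad then c else 0))"
    using each by (rule sum_mono)
  also have "\<dots> = (mu + \<delta>) * (\<Sum>X\<in>P. card X) + c * card Bad"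
  proof -
    have "(\<Sum>X\<in>P. if X \<in> Bad then c else 0) = (\<Sum>X\<in>Bad. c)"
      using finP by (intro sum.mono_neutral_cong_right) (auto simp: Bad_def)
    then show ?thesis by (simp add: sum.distrib sum_distrib_left)
  qed
  also have "(\<Sum>X\<in>P. card X) = card Z"
    using card_Union_disjoint[of P] dis PZ finZ finite_subset UP by (metis disjnt_def pairwiseI)
  also have "(mu + \<delta>) * card Z + c * card Bad \<le> (mu + \<delta>) * card Y + c * q"
    using num cBad fin unfolding Z_def by (intro add_mono mult_left_mono) (auto intro: card_mono)
  finally show ?thesis unfolding q_def by (simp add: mult.commute)
qed

definition unrealizing :: "nat \<Rightarrow> nat \<Rightarrow> real \<Rightarrow> 'a set set \<Rightarrow> bool" where
  "unrealizing r k lam E \<longleftrightarrow> finite E \<and> (\<forall>e\<in>E. card e = r) \<and> \<not> lpath E k \<and>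
     (\<nexists>(A :: nat set) F. pattern r A F \<and> lam * card A < card F \<and> realized k E A F)"

text \<open>The list ends with a pending edge \<open>e\<close> into \<open>Y\<close>; the vertex at
  which it continues is chosen only in the next round, when a component of the remainder is given.
  The bound on \<open>card S\<close> leaves room for the vertices of all \<open>m + 1\<close>
  edges.\<close>

definition probed :: "nat \<Rightarrow> 'a set set \<Rightarrow> 'a set \<Rightarrow> 'a set \<Rightarrow> nat \<Rightarrow> bool" where
  "probed r E S Y m \<longleftrightarrow> piece E S Y \<and> finite S \<and> card S \<le> r * (m + 1) \<and>
     (\<exists>v xs e. ipath E (Inl v # xs @ [Inr e]) \<and> length xs = 2 * m \<and> path_verts (Inl v # xs) \<inter> Y = {} \<and>
       (\<forall>g\<in>path_edges xs. g \<inter> Y = {}) \<and> e \<in> touching E Y)"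

text \<open>Induction on \<open>d\<close>, which bounds how much further the path probing \<open>Y\<close> can be prolonged into
  \<open>Y\<close>; each step removes the vertices of its last edge from \<open>Y\<close>.\<close>

lemma touching_le:
  fixes lam \<delta> :: real
  assumes k: "k \<ge> 1" and r: "r \<ge> 1" and num: "0 \<le> lam" "0 < \<delta>"
  shows "\<exists>c\<ge>0. \<forall>(E :: 'a set set) S Y m. unrealizing r k lam E \<and> probed r E S Y m \<and> k \<le> m + d
    \<longrightarrow> card (touching E Y) \<le> (lam + \<delta> * real d) * card Y + c"
proof (induction d)
  case 0
  \<comment> \<open>With \<open>m \<ge> k\<close> the probing path itself would have length
    \<open>k\<close>.\<close>
  have "\<not> (unrealizing r k lam E \<and> probed r E S Y m \<and> k \<le> m + 0)" for E :: "'a set set" and S Y m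
  proof
    assume H: "unrealizing r k lam E \<and> probed r E S Y m \<and> k \<le> m + 0"
    then have "probed r E S Y m" by simp
    then obtain v xs e where xs: "ipath E (Inl v # xs @ [Inr e])" "length xs = 2 * m"
      unfolding probed_def by (elim conjE exE) (rule that)
    then have "lpath E k" using lpathI[OF xs(1), of v k] H by auto
    then show False using H unfolding unrealizing_def by blast
  qed
  then show ?case by (intro exI[of _ "0 :: real"] conjI allI impI order_refl) blast
next
  case (Suc d)
  then obtain c where c: "0 \<le> c" and IH: "\<And>(E :: 'a set set) S Y m. unrealizing r k lam E \<Longrightarrow>
    probed r E S Y m \<Longrightarrow> k \<le> m + d \<Longrightarrow> card (touching E Y) \<le> (lam + \<delta> * real d) * card Y + c" by blast
  \<comment> \<open>\<open>S \<union> e\<close> has at most \<open>r * (m + 2)\<close> vertices, and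
    \<open>m < k\<close>. Like \<open>t\<close> and \<open>c'\<close> below, \<open>s\<close> is
    fixed before the hypergraph, so that the bound is uniform.\<close>
  define s where "s = r * (k + 2)"
  obtain t :: nat where "c / \<delta> \<le> real t" using real_arch_simple by blast
  then have t: "c \<le> \<delta> * real t" using num by (simp add: field_simps)
  define c' where "c' = 2 ^ s + real (k * (2 ^ (s + t) * 2 ^ 2 ^ (s + t))) * c"
  have "c' \<ge> 0" unfolding c'_def using c by simp
  moreover have "card (touching E Y) \<le> (lam + \<delta> * real (Suc d)) * card Y + c'"
    if U: "unrealizing r k lam E" and Q: "probed r E S Y m" and kd: "k \<le> m + Suc d"
    for E :: "'a set set" and S Y and m :: nat
  proof -
    obtain v xs e where
      H: "ipath E (Inl v # xs @ [Inr e])" "length xs = 2 * m" "path_verts (Inl v # xs) \<inter> Y = {}"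
        "\<forall>g\<in>path_edges xs. g \<inter> Y = {}" "e \<in> touching E Y"
      using Q unfolding probed_def by (elim conjE exE) (rule that)
    have Q': "piece E S Y" "finite S" "card S \<le> r * (m + 1)" using Q unfolding probed_def by blast+
    have U': "finite E" "\<And>f. f \<in> E \<Longrightarrow> card f = r" "\<not> lpath E k"
      "\<nexists>(A :: nat set) F. pattern r A F \<and> lam * card A < card F \<and> realized k E A F"
      using U unfolding unrealizing_def by blast+
    have mk: "m < k" using lpathI[OF H(1), of v k] U'(3) H(2) by fastforce
    have eE: "e \<in> E" "e \<inter> Y \<noteq> {}" using H(5) by (auto simp: touching_def)
    have fine: "finite e" using U'(2) eE r by (metis card.infinite not_one_le_zero)
    have cSe: "card (S \<union> e) \<le> r * (m + 2)"
      using card_Un_le[of S e] U'(2) Q'(3) eE by simp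
    have pY: "finite Y" "Y \<inter> S = {}" "\<And>u w. u \<in> Y \<Longrightarrow> w \<in> Y \<Longrightarrow> (u, w) \<in> (link E \<inter> Y \<times> Y)\<^sup>*"
      "\<And>f. f \<in> touching E Y \<Longrightarrow> f \<subseteq> Y \<union> S" using Q'(1) unfolding piece_def by blast+
    have "r * (m + 2) \<le> s" unfolding s_def using mk by (intro mult_le_mono2) simp
    then have cs: "card (S \<union> e) \<le> s" using cSe by linarith
    have "real (card (touching E Y)) \<le> (lam + \<delta> * real d + \<delta>) * card Y + c'"
      unfolding c'_def
    proof (rule touching_decompose[where D = e and S = S and r = r and lam = lam and k = k])
      fix Z assume Z: "Z \<subseteq> Y - e" "piece E (S \<union> e) Z" "\<exists>f\<in>touching E Z. f \<inter> Y \<inter> e \<noteq> {}"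
      then obtain f a where f: "f \<in> touching E Z" "a \<in> f" "a \<in> Y" "a \<in> e" by blast
      then have fE: "f \<in> E" "f \<inter> Z \<noteq> {}" by (auto simp: touching_def)
      \<comment> \<open>The path continues through a common vertex \<open>a\<close> of
        \<open>e\<close> and \<open>Y\<close> to an edge \<open>f\<close> that meets
        \<open>Z\<close>. Earlier edges avoid \<open>Y\<close> and \<open>e\<close> avoids
        \<open>Z\<close>, so \<open>f\<close> is new.\<close>
      have "ipath E ((Inl v # xs @ [Inr e]) @ [Inl a, Inr f])"
      proof (subst ipath_append, intro conjI)
        show "ipath E [Inl a, Inr f]" using f fE by (simp add: ipath_Cons)
        have "Inl a \<notin> set (Inl v # xs @ [Inr e])" using f H(3) by auto
        moreover have "Inr f \<notin> set (Inl v # xs @ [Inr e])" using f fE Z H(4) by auto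
        ultimately show "set (Inl v # xs @ [Inr e]) \<inter> set [Inl a, Inr f] = {}" by auto
      qed (use H(1) f eE in auto)
      then have "ipath E (Inl v # (xs @ [Inr e, Inl a]) @ [Inr f])" by simp
      moreover have "card (S \<union> e) \<le> r * (Suc m + 1)" using cSe by simp
      moreover have "path_verts (Inl v # xs @ [Inr e, Inl a]) \<inter> Z = {}" using H(3) Z f by auto
      moreover have "\<forall>g\<in>path_edges (xs @ [Inr e, Inl a]). g \<inter> Z = {}" using H(4) Z by auto
      moreover have "length (xs @ [Inr e, Inl a]) = 2 * Suc m" using H(2) by simp
      ultimately have "probed r E (S \<union> e) Z (Suc m)"
        unfolding probed_def using Z(2) f(1) Q'(2) fine by blast
      then show "card (touching E Z) \<le> (lam + \<delta> * real d) * card Z + c"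
        using U kd by (intro IH) auto
    qed (use U' Q' pY eE fine cs k num c t in auto)
    then show ?thesis by (simp add: algebra_simps)
  qed
  ultimately show ?case by blast
qed

lemma dense_realizes_pattern:
  fixes lam \<delta> :: real
  assumes k: "k \<ge> 1" and r: "r \<ge> 1" and num: "0 \<le> lam" "0 < \<delta>"
  shows "\<exists>c. \<forall>(E :: 'a set set) V. finite E \<and> finite V \<and> V \<noteq> {} \<and> (\<forall>e\<in>E. e \<subseteq> V \<and> card e = r) \<and> \<not> lpath E k \<and>
    (\<forall>u\<in>V. \<forall>w\<in>V. (u, w) \<in> (link E)\<^sup>*) \<and> (lam + \<delta>) * card V + c < card E \<longrightarrow>
    (\<exists>(A :: nat set) F. pattern r A F \<and> lam * card A < card F \<and> realized k E A F)"
proof -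
  \<comment> \<open>The slack is shared equally among \<open>k + 1\<close> rounds. The initial one
    deletes a single vertex, since there is no probing edge yet; \<open>touching_le\<close> accounts
    for the other \<open>k\<close>.\<close>
  define \<epsilon> where "\<epsilon> = \<delta> / real (k + 1)"
  have \<epsilon>: "0 < \<epsilon>" unfolding \<epsilon>_def using num by simp
  obtain c where c: "0 \<le> c" and B: "\<And>(E :: 'a set set) S Y m. unrealizing r k lam E \<Longrightarrow>
    probed r E S Y m \<Longrightarrow> k \<le> m + k \<Longrightarrow> card (touching E Y) \<le> (lam + \<epsilon> * real k) * card Y + c"
    using touching_le[OF k r num(1) \<epsilon>, of k] by blast
  obtain t :: nat where "c / \<epsilon> \<le> real t" using real_arch_simple by blast
  then have t: "c \<le> \<epsilon> * real t" using \<epsilon> by (simp add: field_simps)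
  define c' where "c' = 2 ^ 1 + real (k * (2 ^ (1 + t) * 2 ^ 2 ^ (1 + t))) * c"
  have "\<exists>(A :: nat set) F. pattern r A F \<and> lam * card A < card F \<and> realized k E A F"
    if H: "finite E" "finite V" "V \<noteq> {}" "\<forall>e\<in>E. e \<subseteq> V \<and> card e = r" "\<not> lpath E k"
    "\<forall>u\<in>V. \<forall>w\<in>V. (u, w) \<in> (link E)\<^sup>*" "(lam + \<delta>) * card V + c' < card E" for E :: "'a set set" and V
  proof (rule ccontr)
    assume no: "\<not> ?thesis"
    obtain v where v: "v \<in> V" using H by auto
    have tE: "touching E V = E"
    proof -
      have "e \<inter> V \<noteq> {}" if "e \<in> E" for e
      proof -
        have "e \<subseteq> V" "card e \<noteq> 0" using H(4) that r by auto
        then show ?thesis by (auto simp: Int_absorb2)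
      qed
      then show ?thesis unfolding touching_def by blast
    qed
    have lk: "link E \<inter> V \<times> V = link E" using H(4) unfolding link_def by blast
    have "real (card (touching E V)) \<le> (lam + \<epsilon> * real k + \<epsilon>) * card V + c'"
      unfolding c'_def
    proof (rule touching_decompose[where D = "{v}" and S = "{}" and r = r and lam = lam and k = k])
      fix Z assume Z: "Z \<subseteq> V - {v}" "piece E ({} \<union> {v}) Z" "\<exists>f\<in>touching E Z. f \<inter> V \<inter> {v} \<noteq> {}"
      then obtain f where f: "f \<in> touching E Z" "v \<in> f" by blast
      then have "ipath E (Inl v # [] @ [Inr f])" by (auto simp: ipath_Cons touching_def)
      moreover have "path_verts [Inl v] \<inter> Z = {}" using Z by auto
      ultimately have "probed r E {v} Z 0"
        unfolding probed_def using Z(2) f(1) r by (intro conjI exI[of _ v] exI[of _ "[]"] exI[of _ f]) auto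
      then show "card (touching E Z) \<le> (lam + \<epsilon> * real k) * card Z + c"
        using H no by (intro B[where m = 0 and S = "{v}"]) (auto simp: unrealizing_def)
    qed (use H v k num c t no \<epsilon> tE lk in auto)
    moreover have "lam + \<epsilon> * real k + \<epsilon> = lam + \<delta>"
    proof -
      have "\<epsilon> * real k + \<epsilon> = \<epsilon> * real (k + 1)" by (simp add: algebra_simps)
      also have "\<dots> = \<delta>" unfolding \<epsilon>_def by simp
      finally show ?thesis by simp
    qed
    ultimately show False using H(7) tE by simp
  qed
  then show ?thesis by blast
qed

section \<open>Limits\<close>

lemma lpath_inj_image:
  assumes "lpath E k" "k \<ge> 1" "\<Union>E \<subseteq> W" "inj_on f W" "\<And>e. e \<in> E \<Longrightarrow> f ` e \<in> E'"
  shows "lpath E' k"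
proof -
  obtain v xs where P: "ipath E (Inl v # xs)" "length xs = 2 * k" using assms(1) by (auto simp: lpath_def)
  obtain y ys where ys: "xs = y # ys" using P assms(2) by (cases xs) auto
  then obtain h where "v \<in> h" "h \<in> E" using P by (cases y) (auto simp: ipath_Cons)
  then have "path_verts (Inl v # xs) \<subseteq> W" using ipath_verts_subset[OF P(1)] assms(3) by blast
  moreover have "path_edges xs \<subseteq> E" using ipath_edges_subset[OF P(1)] by auto
  ultimately show ?thesis using assms(3-5) by (intro lpath_image[OF P, of W f E']) auto
qed

text \<open>Pumped hypergraphs have pairs of natural numbers as vertices, whereas extremality
  compares hypergraphs over the given infinite type.\<close>

lemma transport_admissible:
  fixes V :: "'b set"
  assumes inf: "infinite (UNIV :: 'a set)" and fin: "finite V" and E: "\<And>e. e \<in> E \<Longrightarrow> e \<subseteq> V \<and> card e = r"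
    and conn: "\<And>u w. u \<in> V \<Longrightarrow> w \<in> V \<Longrightarrow> (u, w) \<in> (link E)\<^sup>*" and no: "\<not> lpath E k" and k: "k \<ge> 1"
  shows "\<exists>G :: 'a hypergraph. admissible r (card V) k G \<and> card (edges G) = card E"
proof -
  obtain W :: "'a set" where W: "finite W" "card W = card V" using infinite_arbitrarily_large[OF inf] by blast
  then obtain f where f: "inj_on f V" "f ` V \<subseteq> W" using card_le_inj[of V W] fin by auto
  let ?E = "(`) f ` E"
  let ?G = "\<lparr>verts = f ` V, edges = ?E\<rparr>"
  have E': "e \<subseteq> f ` V \<and> card e = r" if "e \<in> ?E" for e
  proof -
    from that obtain e' where e': "e = f ` e'" "e' \<in> E" by blast
    then show ?thesis using E[of e'] inj_on_subset[OF f(1)] by (auto simp: card_image)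
  qed
  have "(f u, f w) \<in> (link ?E)\<^sup>*" if "u \<in> V" "w \<in> V" for u w
    using conn[OF that]
  proof (induction rule: rtrancl_induct)
    case (step y z)
    then have "(f y, f z) \<in> link ?E" unfolding link_def by blast
    with step.IH show ?case by (rule rtrancl_into_rtrancl)
  qed auto
  then have "connected_hypergraph ?G"
    using E' by (subst connected_hypergraph_iff_link) auto
  moreover have "\<not> has_berge_path_of_length ?G k"
  proof
    assume "has_berge_path_of_length ?G k"
    then have "lpath ?E k" using has_berge_path_iff_lpath[of ?G k] E' k by auto
    then have "lpath E k"
    proof (rule lpath_inj_image[OF _ k])
      show "\<Union>?E \<subseteq> f ` V" using E' by blast
      show "inj_on (inv_into V f) (f ` V)" by (rule inj_on_inv_into) simp
      fix e assume "e \<in> ?E"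
      then obtain e' where e': "e = f ` e'" "e' \<in> E" by blast
      then have "inv_into V f ` e = e'" using E f by (metis inv_into_image_cancel)
      then show "inv_into V f ` e \<in> E" using e' by simp
    qed
    with no show False ..
  qed
  moreover have "card (f ` V) = card V" using f by (simp add: card_image)
  ultimately have "admissible r (card V) k ?G"
    unfolding admissible_def uniform_hypergraph_def using E' fin by auto
  moreover have "card ?E = card E"
  proof (rule card_image, rule inj_onI)
    fix e e' assume "e \<in> E" "e' \<in> E" "f ` e = f ` e'"
    then show "e = e'" using inj_on_image_eq_iff[OF f(1)] E by metis
  qed
  ultimately show ?thesis by (metis hypergraph.select_convs(2))
qed

lemma admissible_facts:
  assumes "admissible r n k G" "k \<ge> 1" "r \<ge> 1"
  shows "finite (verts G)" "card (verts G) = n" "finite (edges G)"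
    "\<And>e. e \<in> edges G \<Longrightarrow> e \<subseteq> verts G \<and> card e = r" "\<not> lpath (edges G) k"
    "\<And>u w. u \<in> verts G \<Longrightarrow> w \<in> verts G \<Longrightarrow> (u, w) \<in> (link (edges G))\<^sup>*"
proof -
  show 1: "finite (verts G)" "card (verts G) = n" "\<And>e. e \<in> edges G \<Longrightarrow> e \<subseteq> verts G \<and> card e = r"
    using assms unfolding admissible_def uniform_hypergraph_def by auto
  show "finite (edges G)" using 1 by (meson PowI finite_Pow_iff finite_subset subsetI)
  show "\<not> lpath (edges G) k" using assms 1 has_berge_path_iff_lpath[of G k] unfolding admissible_def by blast
  show "(u, w) \<in> (link (edges G))\<^sup>*" if "u \<in> verts G" "w \<in> verts G" for u w
    using assms 1 connected_hypergraph_iff_link[of G] that unfolding admissible_def by blast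
qed

text \<open>A slope \<open>lam\<close> above the threshold of \<open>reach_single_step\<close>
  guarantees the one-vertex step, so one dense hypergraph yields dense ones for all large
  \<open>n\<close>. The constant \<open>c\<close> does not depend on \<open>N\<close>.\<close>

lemma dense_admissible_propagates:
  fixes lam \<delta> :: real
  assumes inf: "infinite (UNIV :: 'a set)" and k: "k \<ge> 1" and r: "r \<ge> 2" and \<delta>: "\<delta> > 0"
    and lam: "real (2 * (r - 1) * ((k - 1) + ((k - 1) choose (r - 2)))) \<le> lam"
  shows "\<exists>c. \<forall>N (G :: 'a hypergraph). N \<ge> 1 \<and> admissible r N k G \<and> (lam + \<delta>) * N + c < card (edges G) \<longrightarrow>
    (\<exists>n0 C. \<forall>n\<ge>n0. \<exists>G' :: 'a hypergraph. admissible r n k G' \<and> lam * n \<le> card (edges G') + (C::real))"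
proof -
  have lam0: "lam \<ge> 0" using lam of_nat_0_le_iff order_trans by blast
  have r1: "r \<ge> 1" using r by simp
  obtain c where c: "\<forall>(E :: 'a set set) V. finite E \<and> finite V \<and> V \<noteq> {} \<and> (\<forall>e\<in>E. e \<subseteq> V \<and> card e = r) \<and> \<not> lpath E k \<and>
    (\<forall>u\<in>V. \<forall>w\<in>V. (u, w) \<in> (link E)\<^sup>*) \<and> (lam + \<delta>) * card V + c < card E \<longrightarrow>
    (\<exists>(A :: nat set) F. pattern r A F \<and> lam * card A < card F \<and> realized k E A F)"
    using dense_realizes_pattern[OF k r1 lam0 \<delta>] by (elim exE) (rule that)
  have "\<exists>n0 C. \<forall>n\<ge>n0. \<exists>G' :: 'a hypergraph. admissible r n k G' \<and> lam * n \<le> card (edges G') + (C::real)"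
    if N: "N \<ge> 1" "admissible r N k G" "(lam + \<delta>) * N + c < card (edges G)" for N and G :: "'a hypergraph"
  proof -
    note G = admissible_facts[OF N(2) k r1]
    have "verts G \<noteq> {}" using G(2) N(1) by auto
    then obtain A :: "nat set" and F where AF: "pattern r A F" "lam * card A < card F" "realized k (edges G) A F"
      using c[rule_format, of "edges G" "verts G"] G N(3) by auto
    have no: "\<not> lpath (pump A F) k" using no_lpath_pump[OF AF(3) G(5) k] .
    have "real (2 * (r - 1) * ((k - 1) + ((k - 1) choose (r - 2)))) * card A \<le> lam * card A"
      using lam by (intro mult_right_mono) auto
    then have "real (2 * (r - 1) * ((k - 1) + ((k - 1) choose (r - 2))) * card A) < real (card F)"
      using AF(2) by simp
    then have "2 * (r - 1) * ((k - 1) + ((k - 1) choose (r - 2))) * card A < card F"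
      by (simp only: of_nat_less_iff)
    then obtain B z where "reach A F B" "z \<in> A - B" "reach A F (insert z B)"
      using reach_single_step[OF AF(1) r no k] by blast
    from pump_hypergraph[OF AF(1) r1 this]
    obtain n0 C where nC: "\<And>n. n \<ge> n0 \<Longrightarrow> \<exists>V E. finite V \<and> card V = n \<and> (\<forall>e\<in>E. e \<subseteq> V \<and> card e = r) \<and>
      (\<forall>u\<in>V. \<forall>w\<in>V. (u, w) \<in> (link E)\<^sup>*) \<and> E \<subseteq> pump A F \<and> card F * n \<le> card A * card E + C" by blast
    have cA: "card A \<ge> 1" using AF(1) unfolding pattern_def by (simp add: Suc_leI card_gt_0_iff)
    have "\<exists>G' :: 'a hypergraph. admissible r n k G' \<and> lam * n \<le> card (edges G') + real C" if n: "n \<ge> n0" for n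
    proof -
      obtain V E where VE: "finite V" "card V = n" "\<forall>e\<in>E. e \<subseteq> V \<and> card e = r"
        "\<forall>u\<in>V. \<forall>w\<in>V. (u, w) \<in> (link E)\<^sup>*" "E \<subseteq> pump A F" "card F * n \<le> card A * card E + C"
        using nC[OF n] by blast
      have "\<not> lpath E k" using no lpath_mono[OF _ VE(5)] by blast
      then obtain G' :: "'a hypergraph" where G': "admissible r n k G'" "card (edges G') = card E"
        using transport_admissible[OF inf VE(1), of E r k] VE(2-4) k by blast
      have "card A * (lam * n) \<le> card F * n"
      proof -
        have "lam * card A * n \<le> card F * n" 
          using AF(2) unfolding of_nat_mult by (intro mult_right_mono) auto
        then show ?thesis by (simp add: mult_ac)
      qed
      also have "\<dots> \<le> card A * card E + real C" using VE(6) by (metis of_nat_add of_nat_le_iff of_nat_mult)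
      also have "\<dots> \<le> card A * card E + card A * real C" using cA by (simp add: mult_le_cancel_right1)
      also have "\<dots> = card A * (card E + real C)" by (simp add: distrib_left)
      finally have "lam * n \<le> card E + real C" using cA by simp
      then show ?thesis using G' by auto
    qed
    then show ?thesis by blast
  qed
  then show ?thesis by blast
qed

section \<open>Existence of the inner limit\<close>

text \<open>A substitute for Fekete's lemma: the limit is the supremum of the slopes that
  \<open>a\<close> eventually dominates up to a constant. A slope beyond it is not dominated, so by
  propagation \<open>a\<close> never exceeds it by more than a constant and an arbitrarily small
  slope.\<close>

lemma tendsto_ratio_of_propagation:
  fixes a :: "nat \<Rightarrow> real"
  assumes up: "\<And>n. n \<ge> m \<Longrightarrow> a n \<le> D * n + K" and lo: "\<And>n. n \<ge> m \<Longrightarrow> d * n \<le> a n + K'"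
    and propagates: "\<And>lam \<delta>. d < lam \<Longrightarrow> \<delta> > 0 \<Longrightarrow>
      \<exists>c. \<forall>N\<ge>m. (lam + \<delta>) * N + c < a N \<longrightarrow> (\<exists>n0 C. \<forall>n\<ge>n0. lam * n \<le> a n + C)"
  shows "\<exists>L. (\<lambda>n. a n / n) \<longlonglongrightarrow> L \<and> d \<le> L \<and> L \<le> D"
proof -
  define \<Lambda> where "\<Lambda> = {lam. \<exists>n0 C. \<forall>n\<ge>n0. lam * real n \<le> a n + C}"
  have small: "\<forall>\<^sub>F n in sequentially. C / real n < \<epsilon>" if "\<epsilon> > 0" for C \<epsilon> :: real
    using order_tendstoD(2)[OF lim_const_over_n[of C] that] .
  have le_D: "lam \<le> D" if mem: "lam \<in> \<Lambda>" for lam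
  proof (rule ccontr)
    assume "\<not> lam \<le> D"
    obtain n0 C where C: "\<And>n. n \<ge> n0 \<Longrightarrow> lam * real n \<le> a n + C" using mem unfolding \<Lambda>_def by blast
    have "\<forall>\<^sub>F n in sequentially. (K + C) / real n < lam - D \<and> n \<ge> max n0 (max m 1)"
      using small[of "lam - D" "K + C"] \<open>\<not> lam \<le> D\<close>
      by (intro eventually_conj eventually_ge_at_top) auto
    then obtain n where n: "(K + C) / real n < lam - D" "n \<ge> n0" "n \<ge> m" "n \<ge> 1"
      by (auto dest!: eventually_happens)
    have "K + C < (lam - D) * n" using n by (simp add: field_simps)
    then show False using C[OF n(2)] up[OF n(3)] by (simp add: algebra_simps)
  qed
  have d: "d \<in> \<Lambda>" unfolding \<Lambda>_def using lo by blast
  have bdd: "bdd_above \<Lambda>" using le_D by (rule bdd_aboveI)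
  define L where "L = Sup \<Lambda>"
  have dL: "d \<le> L" unfolding L_def using d bdd by (rule cSup_upper)
  have LD: "L \<le> D" unfolding L_def using d le_D by (intro cSup_least) auto
  have "(\<lambda>n. a n / n) \<longlonglongrightarrow> L"
  proof (rule order_tendstoI)
    fix y assume "y < L"
    then obtain lam where lam: "lam \<in> \<Lambda>" "y < lam" unfolding L_def using d less_cSupE by (metis empty_iff)
    then obtain n0 C where C: "\<And>n. n \<ge> n0 \<Longrightarrow> lam * real n \<le> a n + C" unfolding \<Lambda>_def by blast
    have "\<forall>\<^sub>F n in sequentially. C / real n < lam - y" using lam by (intro small) simp
    moreover have "\<forall>\<^sub>F n in sequentially. n \<ge> max n0 1" by (rule eventually_ge_at_top)
    ultimately show "\<forall>\<^sub>F n in sequentially. y < a n / n"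
    proof eventually_elim
      case (elim n)
      then have "lam * real n \<le> a n + C" "C < (lam - y) * n" using C by (auto simp: field_simps)
      then have "y * n < a n" by (simp add: algebra_simps)
      then show ?case using elim by (simp add: field_simps)
    qed
  next
    fix y assume y: "L < y"
    \<comment> \<open>One third passes the supremum, one is the slack of the propagation, and one
      absorbs the constant \<open>c\<close>.\<close>
    define \<delta> where "\<delta> = (y - L) / 3"
    have \<delta>: "\<delta> > 0" "y = L + 3 * \<delta>" unfolding \<delta>_def using y by (simp_all add: field_simps)
    obtain c where c: "\<And>N. N \<ge> m \<Longrightarrow> (L + \<delta> + \<delta>) * N + c < a N \<Longrightarrow> \<exists>n0 C. \<forall>n\<ge>n0. (L + \<delta>) * real n \<le> a n + C"
      using propagates[of "L + \<delta>" \<delta>] dL \<delta> by auto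
    have "\<not> (\<exists>n0 C. \<forall>n\<ge>n0. (L + \<delta>) * real n \<le> a n + C)"
    proof
      assume "\<exists>n0 C. \<forall>n\<ge>n0. (L + \<delta>) * real n \<le> a n + C"
      then have "L + \<delta> \<in> \<Lambda>" unfolding \<Lambda>_def by blast
      then have "L + \<delta> \<le> L" unfolding L_def using bdd by (rule cSup_upper)
      then show False using \<delta> by simp
    qed
    then have ub: "a N \<le> (L + \<delta> + \<delta>) * N + c" if "N \<ge> m" for N using c[OF that] by (meson not_le)
    have "\<forall>\<^sub>F n in sequentially. c / real n < \<delta>" using \<delta> by (intro small)
    moreover have "\<forall>\<^sub>F n in sequentially. n \<ge> max m 1" by (rule eventually_ge_at_top)
    ultimately show "\<forall>\<^sub>F n in sequentially. a n / n < y"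
    proof eventually_elim
      case (elim n)
      then have "c < \<delta> * n" by (simp add: field_simps)
      moreover have "a n \<le> (L + \<delta> + \<delta>) * n + c" using ub elim by simp
      ultimately have "a n < y * n" unfolding \<delta>(2) by (simp add: algebra_simps)
      then show ?case using elim by (simp add: field_simps)
    qed
  qed
  then show ?thesis using dL LD by blast
qed

section \<open>Asymptotics of the bounds in \<open>k\<close>\<close>

lemma tendsto_binomial_ratio:
  fixes f :: "nat \<Rightarrow> nat"
  assumes "(\<lambda>k. real (f k) / real k) \<longlonglongrightarrow> \<alpha>"
  shows "(\<lambda>k. real (f k choose m) / real k ^ m) \<longlonglongrightarrow> \<alpha> ^ m / fact m"
proof -
  have eq: "real (f k choose m) / real k ^ m = (\<Prod>i=0..<m. real (f k) / real k - real i / real k) / fact m" for k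
  proof -
    have "real (f k choose m) = (\<Prod>i=0..<m. real (f k) - real i) / fact m"
      by (simp add: binomial_gbinomial gbinomial_prod_rev)
    moreover have "(\<Prod>i=0..<m. real (f k) / real k - real i / real k) = (\<Prod>i=0..<m. real (f k) - real i) / real k ^ m"
      by (simp add: prod_dividef flip: diff_divide_distrib)
    ultimately show ?thesis by simp
  qed
  have "(\<lambda>k. \<Prod>i=0..<m. real (f k) / real k - real i / real k) \<longlonglongrightarrow> (\<Prod>i=0..<m. \<alpha> - 0)"
    by (intro tendsto_prod tendsto_diff assms lim_const_over_n)
  then have "(\<lambda>k. (\<Prod>i=0..<m. real (f k) / real k - real i / real k) / fact m) \<longlonglongrightarrow> (\<Prod>i=0..<m. \<alpha> - 0) / fact m"
    by (intro tendsto_divide tendsto_const) auto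
  then show ?thesis unfolding eq by simp
qed

lemma tendsto_half_ratio:
  fixes f :: "nat \<Rightarrow> nat"
  assumes "\<And>k. real k / 2 - 1 \<le> real (f k) \<and> real (f k) \<le> real k / 2"
  shows "(\<lambda>k. real (f k) / real k) \<longlonglongrightarrow> 1 / 2"
proof (rule tendsto_sandwich)
  have "(\<lambda>k. 1 / 2 - 1 / real k) \<longlonglongrightarrow> 1 / 2 - 0" by (intro tendsto_diff tendsto_const lim_const_over_n)
  then show "(\<lambda>k. 1 / 2 - 1 / real k) \<longlonglongrightarrow> 1 / 2" by simp
  show "\<forall>\<^sub>F k in sequentially. 1 / 2 - 1 / real k \<le> real (f k) / real k"
    using eventually_gt_at_top[of 0]
  proof eventually_elim
    case (elim k)
    then have "1 / 2 - 1 / real k = (real k / 2 - 1) / real k" by (simp add: diff_divide_distrib)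
    also have "\<dots> \<le> real (f k) / real k" using assms[of k] by (intro divide_right_mono) auto
    finally show ?case .
  qed
  show "\<forall>\<^sub>F k in sequentially. real (f k) / real k \<le> 1 / 2"
    using eventually_gt_at_top[of 0]
  proof eventually_elim
    case (elim k)
    then show ?case using assms[of k] by (simp add: field_simps)
  qed
qed auto


text \<open>Here \<open>r \<ge> 3\<close> enters: for \<open>r = 2\<close> the first quotient is 1
  for every \<open>k > 0\<close>, and the error term \<open>k\<close> in the degree bound would have
  the order of the main term.\<close>

lemma tendsto_lower_order:
  fixes r :: nat
  assumes r: "r \<ge> 3"
  shows "(\<lambda>k. real k / real k ^ (r - 1)) \<longlonglongrightarrow> 0"
    and "(\<lambda>k. real (k choose (r - 2)) / real k ^ (r - 1)) \<longlonglongrightarrow> 0"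
proof -
  have r1: "r - 1 = Suc (r - 2)" "r - 2 = Suc (r - 3)" using r by simp_all
  have pw: "x ^ (r - 1) = x * x ^ (r - 2)" for x :: real unfolding r1(1) by simp
  have inv: "(\<lambda>k. 1 / real k) \<longlonglongrightarrow> 0" by (rule lim_const_over_n)
  have "(\<lambda>k. (1 / real k) ^ (r - 2)) \<longlonglongrightarrow> 0 ^ (r - 2)" using inv by (rule tendsto_power)
  then have "(\<lambda>k. (1 / real k) ^ (r - 2)) \<longlonglongrightarrow> 0" using r1 by simp
  moreover have "\<forall>\<^sub>F k in sequentially. (1 / real k) ^ (r - 2) = real k / real k ^ (r - 1)"
    using eventually_gt_at_top[of 0] unfolding pw by eventually_elim (simp add: power_one_over)
  ultimately show "(\<lambda>k. real k / real k ^ (r - 1)) \<longlonglongrightarrow> 0"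
    by (rule Lim_transform_eventually)
  have one: "(\<lambda>k. real k / real k) \<longlonglongrightarrow> 1"
    by (rule tendsto_eventually, rule eventually_mono[OF eventually_gt_at_top[of 0]]) simp
  have "(\<lambda>k. real (k choose (r - 2)) / real k ^ (r - 2) * (1 / real k)) \<longlonglongrightarrow> 1 ^ (r - 2) / fact (r - 2) * 0"
    by (intro tendsto_mult tendsto_binomial_ratio one inv)
  then show "(\<lambda>k. real (k choose (r - 2)) / real k ^ (r - 1)) \<longlonglongrightarrow> 0"
    unfolding pw by (simp add: mult.commute)
qed

section \<open>The iterated limit\<close>

theorem theorem7:
  fixes r :: nat and H :: "nat \<Rightarrow> nat \<Rightarrow> 'a hypergraph"
  assumes "r \<ge> 3"
    and "infinite (UNIV :: 'a set)"
    and "\<And>n k. n \<ge> 1 \<Longrightarrow> k \<ge> 1 \<Longrightarrow> \<exists>G :: 'a hypergraph. admissible r n k G \<Longrightarrow>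
           extremal r n k (H n k)"
  shows "(\<forall>\<^sub>F k in sequentially.
            convergent (\<lambda>n. real (card (edges (H n k))) / (real k ^ (r - 1) * real n))) \<and>
         (\<lambda>k. lim (\<lambda>n. real (card (edges (H n k))) / (real k ^ (r - 1) * real n)))
           \<longlonglongrightarrow> 1 / (2 ^ (r - 1) * fact (r - 1))"
proof -
  note r = assms(1) and inf = assms(2) and ext = assms(3)
  \<comment> \<open>For \<open>k \<ge> 1\<close> this is the largest \<open>s\<close> with
    \<open>2 * s + 1 \<le> k\<close>, as the lower-bound construction requires.\<close>
  define s where "s k = (k - 1) div 2" for k :: nat
  \<comment> \<open>The slope in \<open>edges_le_of_no_path\<close> for
    \<open>m = k div 2\<close>.\<close>
  define D where "D k = (k div 2 choose (r - 1)) + k + (k choose (r - 2))" for k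
  define thr where "thr k = 2 * (r - 1) * ((k - 1) + ((k - 1) choose (r - 2)))" for k
  define K where "K k = real k ^ (r - 1)" for k
  define c0 :: real where "c0 = 1 / (2 ^ (r - 1) * fact (r - 1))"
  have c0: "c0 > 0" "(1 / 2) ^ (r - 1) / fact (r - 1) = c0" unfolding c0_def by (simp_all add: power_one_over)
  have half: "real k / 2 - 1 \<le> real (s k) \<and> real (s k) \<le> real k / 2"
    "real k / 2 - 1 \<le> real (k div 2) \<and> real (k div 2) \<le> real k / 2" for k
  proof -
    have "k \<le> 2 * s k + 2" "2 * s k \<le> k" "k \<le> 2 * (k div 2) + 2" "2 * (k div 2) \<le> k"
      unfolding s_def by presburger+
    then show "real k / 2 - 1 \<le> real (s k) \<and> real (s k) \<le> real k / 2"
      "real k / 2 - 1 \<le> real (k div 2) \<and> real (k div 2) \<le> real k / 2" by linarith+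
  qed
  have limlo: "(\<lambda>k. real (s k choose (r - 1)) / K k) \<longlonglongrightarrow> c0"
    unfolding K_def c0(2)[symmetric] using half by (intro tendsto_binomial_ratio tendsto_half_ratio) auto
  have limhi: "(\<lambda>k. real (D k) / K k) \<longlonglongrightarrow> c0"
  proof -
    have "(\<lambda>k. real (k div 2 choose (r - 1)) / K k) \<longlonglongrightarrow> c0"
      unfolding K_def c0(2)[symmetric] using half by (intro tendsto_binomial_ratio tendsto_half_ratio) auto
    then have "(\<lambda>k. real (k div 2 choose (r - 1)) / K k + real k / K k + real (k choose (r - 2)) / K k) \<longlonglongrightarrow> c0 + 0 + 0"
      using tendsto_lower_order[OF r] unfolding K_def by (intro tendsto_add)
    then show ?thesis unfolding D_def by (simp add: add_divide_distrib)
  qed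
  have limthr: "(\<lambda>k. real (thr k) / K k) \<longlonglongrightarrow> 0"
  proof (rule tendsto_sandwich[OF _ _ tendsto_const])
    have "(\<lambda>k. real (2 * (r - 1)) * (real k / K k + real (k choose (r - 2)) / K k)) \<longlonglongrightarrow> real (2 * (r - 1)) * (0 + 0)"
      using tendsto_lower_order[OF r] unfolding K_def by (intro tendsto_mult tendsto_add tendsto_const)
    then show "(\<lambda>k. real (2 * (r - 1)) * (real k / K k + real (k choose (r - 2)) / K k)) \<longlonglongrightarrow> 0" by simp
    show "\<forall>\<^sub>F k in sequentially. real (thr k) / K k \<le> real (2 * (r - 1)) * (real k / K k + real (k choose (r - 2)) / K k)"
    proof (rule always_eventually, rule allI)
      fix k
      have "thr k \<le> 2 * (r - 1) * (k + (k choose (r - 2)))"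
        unfolding thr_def by (intro mult_le_mono2 add_mono binomial_right_mono) auto
      then have "real (thr k) \<le> real (2 * (r - 1) * (k + (k choose (r - 2))))" by (simp only: of_nat_le_iff)
      then have "real (thr k) / K k \<le> real (2 * (r - 1) * (k + (k choose (r - 2)))) / K k"
        unfolding K_def by (intro divide_right_mono) auto
      then show "real (thr k) / K k \<le> real (2 * (r - 1)) * (real k / K k + real (k choose (r - 2)) / K k)"
        by (simp flip: add_divide_distrib)
    qed
    show "\<forall>\<^sub>F k in sequentially. 0 \<le> real (thr k) / K k" unfolding K_def by auto
  qed
  \<comment> \<open>The threshold for the one-vertex step has lower order than the construction, so
    for large \<open>k\<close> propagation applies to every slope above the lower bound.\<close>
  have ev_thr: "\<forall>\<^sub>F k in sequentially. thr k < s k choose (r - 1)"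
  proof -
    have "\<forall>\<^sub>F k in sequentially. real (thr k) / K k < c0 / 2" "\<forall>\<^sub>F k in sequentially. c0 / 2 < real (s k choose (r - 1)) / K k"
      using order_tendstoD(2)[OF limthr, of "c0 / 2"] order_tendstoD(1)[OF limlo, of "c0 / 2"] c0 by auto
    then show ?thesis using eventually_gt_at_top[of 0]
    proof eventually_elim
      case (elim k)
      then have "real (thr k) / K k < real (s k choose (r - 1)) / K k" by linarith
      then show ?case using elim(3) unfolding K_def by (simp add: divide_less_cancel)
    qed
  qed
  have main: "\<exists>L. (\<lambda>n. real (card (edges (H n k))) / (real k ^ (r - 1) * real n)) \<longlonglongrightarrow> L \<and>
      real (s k choose (r - 1)) / K k \<le> L \<and> L \<le> real (D k) / K k"
    if k: "k \<ge> 1" and sk: "r - 1 \<le> s k" and thr: "thr k < s k choose (r - 1)" for k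
  proof -
    define a where "a n = real (card (edges (H n k)))" for n
    have k': "2 * s k + 1 \<le> k" using k unfolding s_def by presburger
    have lower: "\<exists>G :: 'a hypergraph. admissible r n k G \<and> card (edges G) = (s k choose (r - 1)) * (n - s k)"
      if "n \<ge> s k + 1" for n
      using that r sk k' by (intro exists_admissible_bipartite[OF inf]) auto
    have H: "extremal r n k (H n k)" if "n \<ge> s k + 1" for n
      using ext[of n k] lower[OF that] that k by auto
    have a_ge: "real (card (edges G)) \<le> a n" if "n \<ge> s k + 1" "admissible r n k G" for n and G :: "'a hypergraph"
      using H[OF that(1)] that(2) unfolding extremal_def a_def by simp
    have "\<exists>L. (\<lambda>n. a n / n) \<longlonglongrightarrow> L \<and> real (s k choose (r - 1)) \<le> L \<and> L \<le> real (D k)"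
    \<comment> \<open>From \<open>s k + 1\<close> vertices on the construction exists, so
      \<open>H n k\<close> is indeed extremal.\<close>
    proof (rule tendsto_ratio_of_propagation[where m = "s k + 1"])
      fix n assume n: "s k + 1 \<le> n"
      have adm: "admissible r n k (H n k)" using H[OF n] unfolding extremal_def by blast
      have r1: "r \<ge> 1" "r \<ge> 2" using r by auto
      note F = admissible_facts[OF adm k r1(1)]
      have "card (edges (H n k)) \<le> D k * card (verts (H n k)) + 2 ^ k"
        unfolding D_def
        by (rule edges_le_of_no_path[OF F(1,3)]) (use F r1 in \<open>auto\<close>)
      then have "card (edges (H n k)) \<le> D k * n + 2 ^ k" using F(2) by simp
      then have "a n \<le> real (D k * n + 2 ^ k)" unfolding a_def by (simp only: of_nat_le_iff)
      then show "a n \<le> real (D k) * real n + 2 ^ k" by simp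
      obtain G :: "'a hypergraph" where "admissible r n k G" "card (edges G) = (s k choose (r - 1)) * (n - s k)"
        using lower[OF n] by blast
      then have "real ((s k choose (r - 1)) * (n - s k)) \<le> a n" using a_ge[OF n] by metis
      then show "real (s k choose (r - 1)) * real n \<le> a n + real ((s k choose (r - 1)) * s k)"
        using n by (simp add: of_nat_diff right_diff_distrib)
    next
      fix lam \<delta> :: real assume lam: "real (s k choose (r - 1)) < lam" and \<delta>: "\<delta> > 0"
      have "real (thr k) < lam" using thr lam by linarith
      then have "real (2 * (r - 1) * ((k - 1) + ((k - 1) choose (r - 2)))) \<le> lam" unfolding thr_def by simp
      moreover have "r \<ge> 2" using r by simp
      ultimately obtain c where c: "\<And>N (G :: 'a hypergraph). N \<ge> 1 \<and> admissible r N k G \<and> (lam + \<delta>) * N + c < card (edges G) \<Longrightarrow>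
        (\<exists>n0 C. \<forall>n\<ge>n0. \<exists>G' :: 'a hypergraph. admissible r n k G' \<and> lam * n \<le> card (edges G') + (C::real))"
        using dense_admissible_propagates[OF inf k _ \<delta>, of r lam] by blast
      have "\<exists>n0 C. \<forall>n\<ge>n0. lam * real n \<le> a n + C" if N: "N \<ge> s k + 1" "(lam + \<delta>) * N + c < a N" for N
      proof -
        have "admissible r N k (H N k)" using H[OF N(1)] unfolding extremal_def by blast
        then obtain n0 C where C: "\<And>n. n \<ge> n0 \<Longrightarrow> \<exists>G' :: 'a hypergraph. admissible r n k G' \<and> lam * n \<le> card (edges G') + (C::real)"
          using c[of N "H N k"] N unfolding a_def by auto
        have "lam * real n \<le> a n + C" if n: "n \<ge> max n0 (s k + 1)" for n
        proof -
          obtain G' :: "'a hypergraph" where "admissible r n k G'" "lam * n \<le> card (edges G') + C" using C[of n] n by auto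
          then show ?thesis using a_ge[of n G'] n by simp
        qed
        then show ?thesis by blast
      qed
      then show "\<exists>c. \<forall>N\<ge>s k + 1. (lam + \<delta>) * real N + c < a N \<longrightarrow> (\<exists>n0 C. \<forall>n\<ge>n0. lam * real n \<le> a n + C)"
        by blast
    qed
    then obtain L where L: "(\<lambda>n. a n / n) \<longlonglongrightarrow> L" "real (s k choose (r - 1)) \<le> L" "L \<le> real (D k)" by blast
    have "K k > 0" unfolding K_def using k by simp
    have "(\<lambda>n. a n / n / K k) \<longlonglongrightarrow> L / K k" using L(1) \<open>K k > 0\<close> by (intro tendsto_divide tendsto_const) auto
    then have "(\<lambda>n. real (card (edges (H n k))) / (real k ^ (r - 1) * real n)) \<longlonglongrightarrow> L / K k"
      unfolding a_def K_def by (simp add: mult.commute)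
    then show ?thesis using L \<open>K k > 0\<close> by (intro exI[of _ "L / K k"]) (simp add: divide_right_mono)
  qed
  have ev: "\<forall>\<^sub>F k in sequentially. k \<ge> 1 \<and> r - 1 \<le> s k \<and> thr k < s k choose (r - 1)"
    using ev_thr eventually_ge_at_top[of "2 * r"]
  proof eventually_elim
    case (elim k)
    then show ?case using r unfolding s_def by auto
  qed
  have conv: "\<forall>\<^sub>F k in sequentially. convergent (\<lambda>n. real (card (edges (H n k))) / (real k ^ (r - 1) * real n))"
    using ev by eventually_elim (use main in \<open>blast intro: convergentI\<close>)
  have bounds: "real (s k choose (r - 1)) / K k \<le> lim (\<lambda>n. real (card (edges (H n k))) / (real k ^ (r - 1) * real n)) \<and>
      lim (\<lambda>n. real (card (edges (H n k))) / (real k ^ (r - 1) * real n)) \<le> real (D k) / K k"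
    if large: "k \<ge> 1 \<and> r - 1 \<le> s k \<and> thr k < s k choose (r - 1)" for k
  proof -
    obtain L where L: "(\<lambda>n. real (card (edges (H n k))) / (real k ^ (r - 1) * real n)) \<longlonglongrightarrow> L"
      "real (s k choose (r - 1)) / K k \<le> L" "L \<le> real (D k) / K k" using main large by blast
    then show ?thesis using limI[OF L(1)] by simp
  qed
  have "(\<lambda>k. lim (\<lambda>n. real (card (edges (H n k))) / (real k ^ (r - 1) * real n))) \<longlonglongrightarrow> c0"
    by (rule tendsto_sandwich[OF _ _ limlo limhi]; rule eventually_mono[OF ev]; use bounds in blast)
  then show ?thesis using conv unfolding c0_def by blast
qed

end
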